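(* Let $\mu$ be a probability measure on $[0,1]$ satisfying (i) $\mu(\omega(0)=0)=\mu(\omega(0)=1)=0$, (ii) $\mathbb{E}_\mu[\log\rho(0)]=0$, (iii) $\mathbb{E}_\mu[(\log\rho(0))^2]<\infty$, where $\rho(0)=(1-\omega(0))/\omega(0)$. Let $[g_n,d_n]$ be the internal DLA cluster at step $n$ generated by Sinai's walk in the environment $\omega$ (as described in the context), and let $P$ be the annealed law. Then for all $0\le a\le b\le 1$, \[ P\left(\frac{d_n}{n}\in(a,b)\right)\xrightarrow[n\to\infty]{}\int_a^b\frac{1}{\pi\sqrt{x(1-x)}}\,dx, \] i.e. $d_n/n$ converges in law under $P$ to the Arcsine law.
   Context: An environment is $\omega=(\omega(i))_{i\in\mathbb{Z}}\in\Omega:=[0,1]^{\mathbb{Z}}$; set $\rho(i)=(1-\omega(i))/\omega(i)$. The environment is random with law $\mathbb{P}=\mu^{\otimes\mathbb{Z}}$. For fixed $\omega$, $\tilde P_\omega$ is the law of the Markov chain $(X_n)_{n\ge0}$ on $\mathbb{Z}$ with $X_0=0$, $\tilde P_\omega(X_{n+1}=x+1\mid X_n=x)=\omega(x)$, $\tilde P_\omega(X_{n+1}=x-1\mid X_n=x)=1-\omega(x)$. Let $(X^j)_{j\in\mathbb{N}}$ be i.i.d. walks each of law $\tilde P_\omega$ (same environment for all), with joint law $P_\omega=\tilde P_\omega^{\otimes\mathbb{N}}$, and $P=\int_\Omega P_\omega\,d\mathbb{P}$ (annealed law). The cluster is defined by $\theta_0=0$, $A(0)=\{0\}$, and for $j>0$: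 $\theta_j=\inf\{n\ge0: X^j(n)\notin A(j-1)\}$, $A(j)=A(j-1)\cup\{X^j(\theta_j)\}$. Each $A(n)$ is an integer interval, written $[g_n,d_n]$.
   Formalization: The formal statement adds the non-degeneracy condition that ω(0) is not almost surely 1/2; for μ = δ_{1/2} (simple random walk) conditions (i)–(iii) hold but d_n/n → 1/2, so the arcsine limit fails. *)

theory Defs
  imports "HOL-Probability.Probability"
begin

text \<open>Annealed probability space: an environment \<open>\<omega> :: int \<Rightarrow> real\<close> with law
  \<open>\<mu>\<^sup>\<otimes>\<int>\<close>, together with an i.i.d. family of uniform [0,1] variables
  \<open>U (j,n)\<close> that drive the walks: walk \<open>j\<close> at time \<open>n\<close> at site \<open>x\<close> jumps to
  \<open>x+1\<close> iff \<open>U (j,n) < \<omega> x\<close> (probability \<open>\<omega> x\<close>), else to \<open>x-1\<close>.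
  Given \<open>\<omega>\<close>, the walks \<open>X^j\<close> are i.i.d. with law \<open>P~_\<omega>\<close>, so the joint law of
  \<open>(\<omega>, (X^j)_j)\<close> is exactly the annealed law \<open>P\<close>.\<close>

definition annealed_space :: "real measure \<Rightarrow> ((int \<Rightarrow> real) \<times> (nat \<times> nat \<Rightarrow> real)) measure" where
  "annealed_space mu =
     (\<Pi>\<^sub>M i\<in>(UNIV::int set). mu) \<Otimes>\<^sub>M
     (\<Pi>\<^sub>M k\<in>(UNIV::(nat\<times>nat) set). uniform_measure lborel {0..1::real})"

fun walk :: "(int \<Rightarrow> real) \<Rightarrow> (nat \<times> nat \<Rightarrow> real) \<Rightarrow> nat \<Rightarrow> nat \<Rightarrow> int" where
  "walk \<omega> U j 0 = 0"
| "walk \<omega> U j (Suc n) =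
     walk \<omega> U j n + (if U (j, n) < \<omega> (walk \<omega> U j n) then 1 else -1)"

text \<open>Internal DLA cluster: \<open>A(0) = {0}\<close>, \<open>A(j) = A(j-1) \<union> {X^j(\<theta>_j)}\<close> with
  \<open>\<theta>_j\<close> the first exit time of \<open>X^j\<close> from \<open>A(j-1)\<close>. (If \<open>\<theta>_j = \<infinity>\<close>, a null
  event, the cluster is left unchanged.)\<close>
fun cluster :: "(int \<Rightarrow> real) \<Rightarrow> (nat \<times> nat \<Rightarrow> real) \<Rightarrow> nat \<Rightarrow> int set" where
  "cluster \<omega> U 0 = {0}"
| "cluster \<omega> U (Suc j) =
     (let A = cluster \<omega> U j in
      if \<exists>n. walk \<omega> U (Suc j) n \<notin> A
      then insert (walk \<omega> U (Suc j) (LEAST n. walk \<omega> U (Suc j) n \<notin> A)) A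
      else A)"

definition dright :: "(int \<Rightarrow> real) \<Rightarrow> (nat \<times> nat \<Rightarrow> real) \<Rightarrow> nat \<Rightarrow> int" where
  "dright \<omega> U n = Max (cluster \<omega> U n)"

end

theory Submission
  imports Defs "HOL-Real_Asymp.Real_Asymp"
begin

text \<open>Let \<open>V\<close> be the potential of the environment, a random walk with centred i.i.d. increments
  \<open>log \<rho>\<close>, and let \<open>M\<^sub>+(k)\<close> and \<open>M\<^sub>-(k)\<close> be its maxima over \<open>[0, k]\<close> and \<open>[-k, 0]\<close>.
  Since \<open>exp V\<close> is the discrete derivative of a harmonic function of the walk, each particle reaches
  \<open>q - 1 - n\<close> before \<open>q\<close> with probability at most \<open>n exp (M\<^sub>+(q - 1) - M\<^sub>-(n + 1 - q))\<close>, and symmetrically.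
  A union bound over the first \<open>n\<close> particles shows that \<open>d\<^sub>n < q\<close> is, up to an error that vanishes
  because the difference of the maxima is of order \<open>\<surd>n\<close>, the event \<open>M\<^sub>+(q - 1) > M\<^sub>-(n + 1 - q)\<close>.
  The two maxima are independent and, for \<open>q \<sim> x n\<close>, converge after rescaling to
  \<open>\<surd>x |N\<^sub>1|\<close> and \<open>\<surd>(1 - x) |N\<^sub>2|\<close> with independent standard normal variables, and
  \<open>P(\<surd>x |N\<^sub>1| > \<surd>(1 - x) |N\<^sub>2|) = (2/\<pi>) arcsin \<surd>x\<close>.\<close>

section \<open>Weak convergence of real distributions\<close>

lemma (in prob_space) cdf_distr:
  assumes "f \<in> borel_measurable M"
  shows "cdf (distr M borel f) t = prob {x \<in> space M. f x \<le> t}"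
  using assms by (simp add: cdf_def measure_distr vimage_def Int_def conj_commute)

lemma weak_conv_m_subseq:
  assumes "weak_conv_m \<mu> M" "filterlim k at_top sequentially"
  shows "weak_conv_m (\<lambda>n. \<mu> (k n)) M"
  using assms filterlim_compose[of _ _ sequentially k]
  unfolding weak_conv_m_def weak_conv_def by blast

lemma weak_conv_m_affine:
  fixes r u :: "nat \<Rightarrow> real"
  assumes \<mu>: "\<And>n. real_distribution (\<mu> n)" and M: "real_distribution M" and conv: "weak_conv_m \<mu> M"
    and r_lim: "r \<longlonglongrightarrow> r'" and u_lim: "u \<longlonglongrightarrow> u'"
  shows "weak_conv_m (\<lambda>n. distr (\<mu> n) borel (\<lambda>y. r n * y + u n)) (distr M borel (\<lambda>y. r' * y + u'))"
proof -
  obtain \<Omega> :: "real measure" and Y\<^sub>n :: "nat \<Rightarrow> real \<Rightarrow> real" and Y :: "real \<Rightarrow> real"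
    where \<Omega>: "prob_space \<Omega>"
      and Y_measurable [measurable]: "\<And>n. Y\<^sub>n n \<in> borel_measurable \<Omega>" "Y \<in> borel_measurable \<Omega>"
      and law: "\<And>n. distr \<Omega> borel (Y\<^sub>n n) = \<mu> n" "distr \<Omega> borel Y = M"
      and lim: "\<And>x. x \<in> space \<Omega> \<Longrightarrow> (\<lambda>n. Y\<^sub>n n x) \<longlonglongrightarrow> Y x"
    using Skorohod[OF \<mu> M conv] unfolding measurable_lborel1 by blast
  interpret \<Omega>: prob_space \<Omega> by fact
  have affine_law: "distr (distr \<Omega> borel Z) borel (\<lambda>y. c * y + d) = distr \<Omega> borel (\<lambda>x. c * Z x + d)"
    if "Z \<in> borel_measurable \<Omega>" for Z :: "real \<Rightarrow> real" and c d
    using that by (simp add: distr_distr comp_def)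
  show ?thesis
    unfolding law[symmetric] affine_law[OF Y_measurable(1)] affine_law[OF Y_measurable(2)]
  proof (rule integral_bdd_continuous_conv_imp_weak_conv)
    fix f :: "real \<Rightarrow> real"
    assume f_test: "\<And>x. isCont f x" "\<And>x. \<bar>f x\<bar> \<le> 1"
    then have [measurable]: "f \<in> borel_measurable borel"
      by (simp add: borel_measurable_continuous_onI continuous_at_imp_continuous_on)
    have "(\<lambda>n. \<Omega>.expectation (\<lambda>x. f (r n * Y\<^sub>n n x + u n))) \<longlonglongrightarrow> \<Omega>.expectation (\<lambda>x. f (r' * Y x + u'))"
    proof (rule integral_dominated_convergence[where w = "\<lambda>_. 1"])
      show "AE x in \<Omega>. (\<lambda>n. f (r n * Y\<^sub>n n x + u n)) \<longlonglongrightarrow> f (r' * Y x + u')"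
        using lim r_lim u_lim by (intro AE_I2 isCont_tendsto_compose[OF f_test(1)] tendsto_intros)
    qed (use f_test in auto)
    then show "(\<lambda>n. integral\<^sup>L (distr \<Omega> borel (\<lambda>x. r n * Y\<^sub>n n x + u n)) f)
        \<longlonglongrightarrow> integral\<^sup>L (distr \<Omega> borel (\<lambda>x. r' * Y x + u')) f"
      by (simp add: integral_distr)
  qed (auto intro!: \<Omega>.real_distribution_distr)
qed

lemma weak_conv_m_tendsto_cdf:
  assumes \<mu>: "\<And>n. real_distribution (\<mu> n)" and M: "real_distribution M" and conv: "weak_conv_m \<mu> M"
    and cont: "isCont (cdf M) t" and u_lim: "u \<longlonglongrightarrow> t"
  shows "(\<lambda>n. cdf (\<mu> n) (u n)) \<longlonglongrightarrow> cdf M t"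
proof -
  interpret M: real_distribution M by fact
  have shift: "measure (distr N borel (\<lambda>y. 1 * y + - c)) A = measure N {y. y - c \<in> A}"
    if "real_distribution N" "A \<in> sets borel" for N A and c :: real
  proof -
    interpret N: real_distribution N by fact
    show ?thesis using that(2) by (simp add: measure_distr vimage_def)
  qed
  have shift_cdf: "cdf (distr N borel (\<lambda>y. 1 * y + - c)) 0 = cdf N c"
    if "real_distribution N" for N and c :: real
    unfolding cdf_def by (subst shift[OF that]) (auto intro: arg_cong[where f = "measure N"])
  interpret D: real_distribution "distr M borel (\<lambda>y. 1 * y + - t)"
    by (intro M.real_distribution_distr) simp
  have "isCont (cdf (distr M borel (\<lambda>y. 1 * y + - t))) 0"
    using shift[OF M, of "{0}" t] cont unfolding D.isCont_cdf M.isCont_cdf by simp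
  moreover have "weak_conv_m (\<lambda>n. distr (\<mu> n) borel (\<lambda>y. 1 * y + - u n)) 
      (distr M borel (\<lambda>y. 1 * y + - t))"
    by (intro weak_conv_m_affine \<mu> M conv tendsto_const tendsto_minus u_lim)
  ultimately have "(\<lambda>n. cdf (distr (\<mu> n) borel (\<lambda>y. 1 * y + - u n)) 0)
      \<longlonglongrightarrow> cdf (distr M borel (\<lambda>y. 1 * y + - t)) 0"
    unfolding weak_conv_m_def weak_conv_def by blast
  then show ?thesis unfolding shift_cdf[OF \<mu>] shift_cdf[OF M] .
qed

lemma cdf_tendsto_0:
  assumes \<mu>: "\<And>n. real_distribution (\<mu> n)" and M: "real_distribution M" and "a < b" "cdf M a = 0" "x \<le> a"
    and lim: "\<And>s. a < s \<Longrightarrow> s < b \<Longrightarrow> (\<lambda>n. cdf (\<mu> n) s) \<longlonglongrightarrow> cdf M s"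
  shows "(\<lambda>n. cdf (\<mu> n) x) \<longlonglongrightarrow> 0"
proof (rule order_tendstoI)
  interpret M: real_distribution M by fact
  interpret \<mu>: real_distribution "\<mu> n" for n by fact
  show "eventually (\<lambda>n. y < cdf (\<mu> n) x) sequentially" if "y < 0" for y
    using that by (intro always_eventually allI less_le_trans[OF _ \<mu>.cdf_nonneg])
  fix y :: real assume "0 < y"
  then have "eventually (\<lambda>s. cdf M s < y \<and> s \<in> {a<..<b}) (at_right a)"
    using M.cdf_is_right_cont[of a] \<open>a < b\<close> \<open>cdf M a = 0\<close>
    by (intro eventually_conj eventually_at_right_real order_tendstoD(2)[of "cdf M" 0])
       (auto simp: continuous_within)
  then obtain s where "cdf M s < y" "a < s" "s < b"
    by (auto dest: eventually_happens'[OF trivial_limit_at_right_real])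
  then have "eventually (\<lambda>n. cdf (\<mu> n) s < y) sequentially"
    by (intro order_tendstoD(2)[OF lim])
  then show "eventually (\<lambda>n. cdf (\<mu> n) x < y) sequentially"
    by eventually_elim (use \<mu>.cdf_nondecreasing[of x s] \<open>x \<le> a\<close> \<open>a < s\<close> in \<open>auto intro: le_less_trans\<close>)
qed

lemma cdf_tendsto_1:
  assumes \<mu>: "\<And>n. real_distribution (\<mu> n)" and M: "real_distribution M"
    and "a < b" "measure M {..<b} = 1" "b \<le> x"
    and lim: "\<And>s. a < s \<Longrightarrow> s < b \<Longrightarrow> (\<lambda>n. cdf (\<mu> n) s) \<longlonglongrightarrow> cdf M s"
  shows "(\<lambda>n. cdf (\<mu> n) x) \<longlonglongrightarrow> 1"
proof (rule order_tendstoI)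
  interpret M: real_distribution M by fact
  interpret \<mu>: real_distribution "\<mu> n" for n by fact
  show "eventually (\<lambda>n. cdf (\<mu> n) x < y) sequentially" if "1 < y" for y
    using that by (intro always_eventually allI le_less_trans[OF \<mu>.cdf_bounded_prob])
  fix y :: real assume "y < 1"
  then have "eventually (\<lambda>s. y < cdf M s \<and> s \<in> {a<..<b}) (at_left b)"
    using M.cdf_at_left[of b] \<open>a < b\<close> \<open>measure M {..<b} = 1\<close>
    by (intro eventually_conj eventually_at_left_real order_tendstoD(1)[of "cdf M" 1]) auto
  then obtain s where "y < cdf M s" "a < s" "s < b"
    by (auto dest: eventually_happens'[OF trivial_limit_at_left_real])
  then have "eventually (\<lambda>n. y < cdf (\<mu> n) s) sequentially"
    by (intro order_tendstoD(1)[OF lim])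
  then show "eventually (\<lambda>n. y < cdf (\<mu> n) x) sequentially"
    by eventually_elim (use \<mu>.cdf_nondecreasing[of s x] \<open>b \<le> x\<close> \<open>s < b\<close> in \<open>auto intro: less_le_trans\<close>)
qed

lemma weak_conv_m_Ioo_support:
  assumes \<mu>: "\<And>n. real_distribution (\<mu> n)" and M: "real_distribution M" and supp: "measure M {a<..<b} = 1"
    and lim: "\<And>x. a < x \<Longrightarrow> x < b \<Longrightarrow> (\<lambda>n. cdf (\<mu> n) x) \<longlonglongrightarrow> cdf M x"
  shows "weak_conv_m \<mu> M"
  unfolding weak_conv_m_def weak_conv_def
proof (intro allI impI)
  fix x
  interpret M: real_distribution M by fact
  have "a < b" using supp by (rule contrapos_pp) simp
  have null: "measure M A = 0" if "A \<in> sets borel" "A \<inter> {a<..<b} = {}" for A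
    using M.finite_measure_Union[of A "{a<..<b}"] M.prob_le_1[of "A \<union> {a<..<b}"] measure_nonneg[of M A]
      that supp
    by simp
  have full: "measure M A = 1" if "A \<in> sets borel" "{a<..<b} \<subseteq> A" for A
    using M.finite_measure_mono[of "{a<..<b}" A] M.prob_le_1[of A] that supp by simp
  consider (left) "x \<le> a" | (inside) "a < x" "x < b" | (right) "b \<le> x" by linarith
  then show "(\<lambda>n. cdf (\<mu> n) x) \<longlonglongrightarrow> cdf M x"
  proof cases
    case left
    then have "cdf M a = 0" "cdf M x = 0" unfolding cdf_def by (auto intro!: null)
    then show ?thesis using cdf_tendsto_0[OF \<mu> M \<open>a < b\<close> _ left lim] by simp
  next
    case right
    then have "measure M {..<b} = 1" "cdf M x = 1" unfolding cdf_def by (auto intro!: full simp: subset_eq)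
    then show ?thesis using cdf_tendsto_1[OF \<mu> M \<open>a < b\<close> _ right lim] by simp
  qed (rule lim)
qed

lemma real_distribution_convolution:
  assumes "real_distribution A" "real_distribution B"
  shows "real_distribution (A \<star> B)"
proof -
  interpret A: real_distribution A by fact
  interpret B: real_distribution B by fact
  interpret pair_prob_space A B ..
  show ?thesis
    unfolding convolution_def by (intro real_distribution_distr) simp
qed

lemma char_convolution:
  assumes "real_distribution A" "real_distribution B"
  shows "char (A \<star> B) t = char A t * char B t"
proof -
  interpret A: real_distribution A by fact
  interpret B: real_distribution B by fact
  interpret pair_prob_space A B ..
  have "integrable (A \<Otimes>\<^sub>M B) (\<lambda>z. iexp (t * (fst z + snd z)))"
    by (rule integrable_const_bound[where B = 1]) auto
  then have "(CLINT z|A \<Otimes>\<^sub>M B. iexp (t * (fst z + snd z))) = (CLINT x|A. CLINT y|B. iexp (t * (x + y)))"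
    by (subst integral_fst'[symmetric]) auto
  also have "\<dots> = (CLINT x|A. iexp (t * x) * char B t)"
    by (simp add: char_def distrib_left exp_add)
  finally show ?thesis
    by (simp add: char_def convolution_def integral_distr case_prod_beta)
qed

lemma weak_conv_m_convolution:
  assumes A_lim: "\<And>n. real_distribution (\<mu> n)" "real_distribution A" "weak_conv_m \<mu> A"
    and B_lim: "\<And>n. real_distribution (\<nu> n)" "real_distribution B" "weak_conv_m \<nu> B"
  shows "weak_conv_m (\<lambda>n. \<mu> n \<star> \<nu> n) (A \<star> B)"
proof (rule levy_continuity)
  show "(\<lambda>n. char (\<mu> n \<star> \<nu> n) t) \<longlonglongrightarrow> char (A \<star> B) t" for t
    unfolding char_convolution[OF A_lim(1) B_lim(1)] char_convolution[OF A_lim(2) B_lim(2)]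
    by (intro tendsto_mult levy_continuity1 A_lim B_lim)
qed (intro real_distribution_convolution A_lim B_lim)+

lemma isCont_cdf_convolution:
  assumes A: "real_distribution A" and B: "real_distribution B" and cont: "\<And>t. isCont (cdf B) t"
  shows "isCont (cdf (A \<star> B)) t"
proof -
  interpret A: real_distribution A by fact
  interpret B: real_distribution B by fact
  interpret real_distribution "A \<star> B" using A B by (rule real_distribution_convolution)
  have "{y. y + x \<in> {t}} = {t - x}" for x by auto
  then have "emeasure (A \<star> B) {t} = (\<integral>\<^sup>+x. emeasure B {t - x} \<partial>A)"
    using convolution_emeasure[of "{t}" A B] A.finite_measure_axioms B.finite_measure_axioms by simp
  also have "\<dots> = 0"
    using cont by (simp add: B.isCont_cdf B.emeasure_eq_measure)
  finally show ?thesis by (simp add: isCont_cdf measure_def)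
qed

lemma convolution_distr:
  assumes "prob_space A" "prob_space B" and f_measurable: "f \<in> borel_measurable A"
    and g_measurable: "g \<in> borel_measurable B"
  shows "distr A borel f \<star> distr B borel g = distr (A \<Otimes>\<^sub>M B) borel (\<lambda>z. f (fst z) + g (snd z))"
proof -
  interpret B: prob_space B by fact
  have "sigma_finite_measure (distr B borel g)"
    using B.prob_space_distr[OF g_measurable] by (rule prob_space_imp_sigma_finite)
  then show ?thesis
    unfolding convolution_def using f_measurable g_measurable
    by (subst pair_measure_distr) (auto simp: distr_distr comp_def case_prod_beta)
qed

lemma (in real_distribution) isCont_cdf_distr:
  assumes cont: "\<And>x. isCont (cdf M) x" and f_measurable: "f \<in> borel_measurable borel"
    and "finite (f -` {t})"
  shows "isCont (cdf (distr M borel f)) t"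
proof -
  interpret D: real_distribution "distr M borel f"
    using f_measurable by (intro real_distribution_distr) simp
  have "measure (distr M borel f) {t} = measure M (f -` {t})"
    using f_measurable by (simp add: measure_distr)
  also have "\<dots> = (\<Sum>x\<in>f -` {t}. measure M {x})"
    using assms(3) by (intro finite_measure_eq_sum_singleton) auto
  also have "\<dots> = 0" using cont by (simp add: isCont_cdf)
  finally show ?thesis by (simp add: D.isCont_cdf)
qed

section \<open>Independence and product spaces\<close>

lemma indep_vars_PiM_coordinates:
  fixes M :: "'i \<Rightarrow> 'a measure"
  assumes "\<And>i. prob_space (M i)"
  shows "prob_space.indep_vars (PiM UNIV M) M (\<lambda>i x. x i) UNIV"
proof -
  interpret prob_space "PiM UNIV M" by (rule prob_space_PiM) (rule assms)
  have "distr (PiM UNIV M) (PiM UNIV M) (\<lambda>x. \<lambda>i\<in>UNIV. x i) = PiM UNIV M"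
    by (simp add: restrict_UNIV distr_id)
  also have "\<dots> = PiM UNIV (\<lambda>i. distr (PiM UNIV M) (M i) (\<lambda>x. x i))"
    by (intro PiM_cong refl distr_PiM_component[symmetric]) (auto intro: assms)
  finally show ?thesis by (subst indep_vars_iff_distr_eq_PiM) auto
qed

lemma (in prob_space) prob_conj_indep_var:
  assumes indep: "indep_var S X T Y" and preds: "Measurable.pred S P" "Measurable.pred T Q"
  shows "\<P>(x in M. P (X x) \<and> Q (Y x)) = \<P>(x in M. P (X x)) * \<P>(x in M. Q (Y x))"
proof -
  have rv: "X x \<in> space S" "Y x \<in> space T" if "x \<in> space M" for x
    using that indep_var_rv1[OF indep] indep_var_rv2[OF indep] by (auto dest: measurable_space)
  have "(\<lambda>x. (X x, Y x)) -` ({s \<in> space S. P s} \<times> {t \<in> space T. Q t}) \<inter> space M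
      = {x \<in> space M. P (X x) \<and> Q (Y x)}"
    "X -` {s \<in> space S. P s} \<inter> space M = {x \<in> space M. P (X x)}"
    "Y -` {t \<in> space T. Q t} \<inter> space M = {x \<in> space M. Q (Y x)}"
    using rv by auto
  moreover have "{s \<in> space S. P s} \<in> sets S" "{t \<in> space T. Q t} \<in> sets T"
    using preds by (simp_all add: pred_def)
  ultimately show ?thesis
    using indep_varD[OF indep, of "{s \<in> space S. P s}" "{t \<in> space T. Q t}"] by simp
qed

lemma (in prob_space) expectation_indep_var:
  fixes g :: "'b \<times> 'b \<Rightarrow> real"
  assumes indep: "indep_var S X T Y" and [measurable]: "g \<in> borel_measurable (S \<Otimes>\<^sub>M T)"
    and g_integrable: "integrable M (\<lambda>x. g (X x, Y x))"
  shows "expectation (\<lambda>x. g (X x, Y x)) = expectation (\<lambda>x. expectation (\<lambda>y. g (X x, Y y)))"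
proof -
  have X [measurable]: "X \<in> measurable M S" and Y [measurable]: "Y \<in> measurable M T"
    and joint: "distr M S X \<Otimes>\<^sub>M distr M T Y = distr M (S \<Otimes>\<^sub>M T) (\<lambda>x. (X x, Y x))"
    using indep by (auto simp: indep_var_distribution_eq)
  interpret X: prob_space "distr M S X" by (rule prob_space_distr) fact
  interpret Y: prob_space "distr M T Y" by (rule prob_space_distr) fact
  interpret XY: pair_prob_space "distr M S X" "distr M T Y" ..
  have inner: "(\<integral>t. g (s, t) \<partial>distr M T Y) = expectation (\<lambda>y. g (s, Y y))" if "s \<in> space S" for s
    using that by (intro integral_distr) measurable
  have "integrable (distr M S X \<Otimes>\<^sub>M distr M T Y) g"
    unfolding joint using g_integrable by (subst integrable_distr_eq) auto
  then have "(\<integral>z. g z \<partial>(distr M S X \<Otimes>\<^sub>M distr M T Y)) = (\<integral>s. \<integral>t. g (s, t) \<partial>distr M T Y \<partial>distr M S X)"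
    by (rule XY.integral_fst'[symmetric])
  also have "\<dots> = expectation (\<lambda>x. \<integral>t. g (X x, t) \<partial>distr M T Y)"
    by (intro integral_distr) measurable
  also have "\<dots> = expectation (\<lambda>x. expectation (\<lambda>y. g (X x, Y y)))"
    using measurable_space[OF X] by (intro Bochner_Integration.integral_cong refl inner)
  finally show ?thesis
    unfolding joint by (simp add: integral_distr)
qed

lemma (in pair_prob_space) prob_le_section:
  assumes Z_sets: "Z \<in> sets (M1 \<Otimes>\<^sub>M M2)" and G_sets: "G \<in> sets M1" and \<delta>_nonneg: "0 \<le> \<delta>"
    and section_le: "AE x in M1. x \<notin> G \<longrightarrow> M2.prob (Pair x -` Z) \<le> \<delta>"
  shows "prob Z \<le> M1.prob G + \<delta>"
proof -
  have "emeasure (M1 \<Otimes>\<^sub>M M2) Z = (\<integral>\<^sup>+x. emeasure M2 (Pair x -` Z) \<partial>M1)"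
    by (rule M2.emeasure_pair_measure_alt[OF Z_sets])
  also have "\<dots> \<le> (\<integral>\<^sup>+x. indicator G x + ennreal \<delta> \<partial>M1)"
  proof (rule nn_integral_mono_AE)
    show "AE x in M1. emeasure M2 (Pair x -` Z) \<le> indicator G x + ennreal \<delta>"
      using section_le
    proof eventually_elim
      case (elim x)
      then show ?case
        using M2.emeasure_le_1[of "Pair x -` Z"] \<delta>_nonneg
        by (cases "x \<in> G") (auto simp: M2.emeasure_eq_measure intro: order_trans[of _ 1])
    qed
  qed
  also have "\<dots> = ennreal (M1.prob G + \<delta>)"
    using G_sets \<delta>_nonneg by (subst nn_integral_add) (auto simp: M1.prob_space M1.emeasure_eq_measure)
  finally show ?thesis
    using \<delta>_nonneg by (simp add: emeasure_eq_measure del: ennreal_plus)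
qed

section \<open>Running maxima\<close>

definition running_max :: "(nat \<Rightarrow> 'a::linorder) \<Rightarrow> nat \<Rightarrow> 'a" where
  "running_max f n = Max (f ` {..n})"

lemma running_max_le_iff: "running_max f n \<le> c \<longleftrightarrow> (\<forall>i\<le>n. f i \<le> c)"
  unfolding running_max_def by (subst Max_le_iff) auto

lemma running_max_ge: "i \<le> n \<Longrightarrow> f i \<le> running_max f n"
  using running_max_le_iff[of f n "running_max f n"] by simp

lemma running_max_attained: obtains i where "i \<le> n" "running_max f n = f i"
proof -
  have "running_max f n \<in> f ` {..n}"
    unfolding running_max_def by (rule Max_in) auto
  then show ?thesis using that by auto
qed

lemma borel_measurable_running_max:
  fixes f :: "nat \<Rightarrow> 'a \<Rightarrow> real"
  assumes "\<And>i. i \<le> n \<Longrightarrow> f i \<in> borel_measurable M"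
  shows "(\<lambda>x. running_max (\<lambda>i. f i x) n) \<in> borel_measurable M"
  unfolding running_max_def using assms by (intro borel_measurable_Max) auto

section \<open>The normal and the arcsine distribution\<close>

lemma isCont_cdf_density_lborel:
  assumes "real_distribution (density lborel f)" "f \<in> borel_measurable lborel"
  shows "isCont (cdf (density lborel f)) x"
proof -
  interpret real_distribution "density lborel f" by fact
  have "emeasure (density lborel f) {x} = 0"
    using assms(2) by (simp add: emeasure_density nn_integral_indicator_singleton)
  then show ?thesis by (simp add: isCont_cdf measure_def)
qed

lemma (in real_distribution) cdf_uminus_symmetric:
  assumes "distr M borel uminus = M" "isCont (cdf M) t"
  shows "cdf M (- t) = 1 - cdf M t"
proof -
  have "cdf M (- t) = cdf (distr M borel uminus) (- t)" by (simp add: assms(1))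
  also have "\<dots> = measure M {t..}"
    by (subst cdf_distr) (auto intro: arg_cong[where f = prob])
  also have "\<dots> = measure M (space M - ({..t} - {t}))"
    by (auto intro: arg_cong[where f = prob])
  also have "\<dots> = 1 - (cdf M t - prob {t})"
    by (subst prob_compl, force, subst finite_measure_Diff) (auto simp: cdf_def)
  finally show ?thesis using assms(2) by (simp add: isCont_cdf)
qed

lemma (in real_distribution) cdf_distr_abs:
  assumes "isCont (cdf M) (- t)"
  shows "cdf (distr M borel abs) t = (if t < 0 then 0 else cdf M t - cdf M (- t))"
proof (cases "t < 0")
  case True
  then have "{x::real. \<bar>x\<bar> \<le> t} = {}" by auto
  with True show ?thesis by (simp add: cdf_distr)
next
  case False
  have "cdf (distr M borel abs) t = prob ({..t} - ({..-t} - {-t}))"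
    by (subst cdf_distr) (auto intro!: arg_cong[where f = prob])
  also have "\<dots> = cdf M t - (cdf M (- t) - prob {-t})"
    using False by (subst finite_measure_Diff; (subst finite_measure_Diff)?) (auto simp: cdf_def)
  finally show ?thesis using False assms by (simp add: isCont_cdf)
qed

interpretation std_normal: real_distribution std_normal_distribution
  by (rule real_dist_normal_dist)

abbreviation \<Phi> :: "real \<Rightarrow> real" where
  "\<Phi> \<equiv> cdf std_normal_distribution"

lemma isCont_cdf_std_normal: "isCont \<Phi> t"
  by (rule isCont_cdf_density_lborel) (auto intro: std_normal.real_distribution_axioms)

lemma distr_uminus_std_normal: "distr std_normal_distribution borel uminus = std_normal_distribution"
proof (rule Levy_uniqueness)
  have "char (distr std_normal_distribution borel uminus) t = char std_normal_distribution (- t)" for t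
    by (simp add: char_def integral_distr)
  then show "char (distr std_normal_distribution borel uminus) = char std_normal_distribution"
    by (simp add: fun_eq_iff char_std_normal_distribution)
qed (auto intro: std_normal.real_distribution_distr std_normal.real_distribution_axioms)

lemma cdf_std_normal_uminus: "\<Phi> (- t) = 1 - \<Phi> t"
  by (intro std_normal.cdf_uminus_symmetric distr_uminus_std_normal isCont_cdf_std_normal)

lemma cdf_std_normal_0: "\<Phi> 0 = 1 / 2"
  using cdf_std_normal_uminus[of 0] by simp

definition scaled_abs_normal :: "real \<Rightarrow> real measure" where
  "scaled_abs_normal c = distr std_normal_distribution borel (\<lambda>u. c * \<bar>u\<bar>)"

lemma real_distribution_scaled_abs_normal: "real_distribution (scaled_abs_normal c)"
  unfolding scaled_abs_normal_def by (intro std_normal.real_distribution_distr) simp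

lemma distr_mult_scaled_abs_normal:
  "distr (scaled_abs_normal c) borel (\<lambda>y. r * y) = scaled_abs_normal (r * c)"
  unfolding scaled_abs_normal_def by (subst distr_distr) (auto simp: comp_def mult.assoc)

lemma cdf_scaled_abs_normal_1:
  "cdf (scaled_abs_normal 1) t = (if t < 0 then 0 else 2 * \<Phi> t - 1)"
  using std_normal.cdf_distr_abs[OF isCont_cdf_std_normal, of t]
  by (simp add: scaled_abs_normal_def cdf_std_normal_uminus)

lemma isCont_cdf_scaled_abs_normal:
  assumes "c \<noteq> 0"
  shows "isCont (cdf (scaled_abs_normal c)) t"
  unfolding scaled_abs_normal_def
proof (rule std_normal.isCont_cdf_distr)
  have "(\<lambda>u. c * \<bar>u\<bar>) -` {t} \<subseteq> {t / c, - (t / c)}"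
    using assms by (auto simp: field_simps abs_if)
  then show "finite ((\<lambda>u. c * \<bar>u\<bar>) -` {t})" by (rule finite_subset) simp
qed (auto intro: isCont_cdf_std_normal)

lemma nn_integral_std_normal_product:
  "(\<integral>\<^sup>+v. ennreal (std_normal_density v * \<bar>v\<bar> * std_normal_density (v * s)) \<partial>lborel)
    = ennreal (1 / (pi * (1 + s\<^sup>2)))"
proof -
  define r where "r = 1 / sqrt (1 + s\<^sup>2)"
  have pos: "1 + s\<^sup>2 > 0" by (simp add: add_pos_nonneg)
  have r_props: "r > 0" "r\<^sup>2 = 1 / (1 + s\<^sup>2)" using pos by (auto simp: r_def power_divide)
  have product: "std_normal_density v * \<bar>v\<bar> * std_normal_density (v * s)
      = r / sqrt (2 * pi) * (normal_density 0 r v * \<bar>v - 0\<bar> ^ (2 * 0 + 1))" for v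
  proof -
    have "exp (- v\<^sup>2 / 2) * exp (- (v * s)\<^sup>2 / 2) = exp (- v\<^sup>2 / (2 * r\<^sup>2))"
      using pos by (simp add: exp_add[symmetric] r_props(2) power_mult_distrib field_simps)
    then show ?thesis using r_props(1)
      by (simp add: normal_density_def real_sqrt_mult field_simps)
  qed
  have "has_bochner_integral lborel
      (\<lambda>v. r / sqrt (2 * pi) * (normal_density 0 r v * \<bar>v - 0\<bar> ^ (2 * 0 + 1)))
      (r / sqrt (2 * pi) * (2 ^ 0 * r ^ (2 * 0 + 1) * fact 0 * sqrt (2 / pi)))"
    using normal_moment_abs_odd[of r 0 0] r_props(1) by (intro has_bochner_integral_mult_right) auto
  also have "r / sqrt (2 * pi) * (2 ^ 0 * r ^ (2 * 0 + 1) * fact 0 * sqrt (2 / pi)) = r\<^sup>2 / pi"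
    by (simp add: real_sqrt_mult real_sqrt_divide power2_eq_square)
  finally have "has_bochner_integral lborel
      (\<lambda>v. std_normal_density v * \<bar>v\<bar> * std_normal_density (v * s)) (r\<^sup>2 / pi)"
    unfolding product .
  then show ?thesis
    by (subst nn_integral_eq_integral) (auto simp: has_bochner_integral_iff r_props(2))
qed

lemma nn_integral_Cauchy_density:
  assumes "c \<ge> 0"
  shows "(\<integral>\<^sup>+s. ennreal (1 / (pi * (1 + s\<^sup>2))) * indicator {-c..c} s \<partial>lborel)
    = ennreal (2 / pi * arctan c)"
proof -
  have "(\<integral>\<^sup>+s. ennreal (1 / (pi * (1 + s\<^sup>2))) * indicator {-c..c} s \<partial>lborel)
      = ennreal (arctan c / pi - arctan (- c) / pi)"
  proof (rule nn_integral_FTC_Icc)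
    fix s :: real
    have "1 + s\<^sup>2 \<noteq> 0" using zero_le_power2[of s] by linarith
    then show "((\<lambda>s. arctan s / pi) has_real_derivative 1 / (pi * (1 + s\<^sup>2))) (at s)"
      by (auto intro!: derivative_eq_intros simp: inverse_eq_divide)
  qed (use assms in \<open>auto simp: add_nonneg_nonneg\<close>)
  then show ?thesis by (simp add: arctan_minus)
qed

text \<open>The substitution \<open>u = v * s\<close> replaces polar coordinates in the computation of the Gaussian cone below.\<close>

lemma emeasure_std_normal_abs_le:
  assumes "v \<noteq> 0"
  shows "emeasure std_normal_distribution {u. \<bar>u\<bar> \<le> c * \<bar>v\<bar>}
    = (\<integral>\<^sup>+s. ennreal (\<bar>v\<bar> * std_normal_density (v * s)) * indicator {-c..c} s \<partial>lborel)"
proof -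
  let ?I = "{u. \<bar>u\<bar> \<le> c * \<bar>v\<bar>}"
  have "emeasure std_normal_distribution ?I
      = (\<integral>\<^sup>+u. ennreal (std_normal_density u) * indicator ?I u \<partial>lborel)"
    by (subst emeasure_density) auto
  also have "\<dots> = ennreal \<bar>v\<bar> * (\<integral>\<^sup>+s. ennreal (std_normal_density (0 + v * s))
      * indicator ?I (0 + v * s) \<partial>lborel)"
    using assms by (intro nn_integral_real_affine) auto
  also have "\<dots> = (\<integral>\<^sup>+s. ennreal \<bar>v\<bar> * (ennreal (std_normal_density (0 + v * s))
      * indicator ?I (0 + v * s)) \<partial>lborel)"
    by (intro nn_integral_cmult[symmetric]) auto
  also have "\<dots> = (\<integral>\<^sup>+s. ennreal (\<bar>v\<bar> * std_normal_density (v * s)) * indicator {-c..c} s \<partial>lborel)"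
  proof (intro nn_integral_cong)
    fix s
    have "\<bar>v * s\<bar> \<le> c * \<bar>v\<bar> \<longleftrightarrow> s \<in> {-c..c}"
      using assms by (auto simp: abs_mult abs_le_iff mult.commute[of "\<bar>v\<bar>"])
    then show "ennreal \<bar>v\<bar> * (ennreal (std_normal_density (0 + v * s)) * indicator ?I (0 + v * s))
        = ennreal (\<bar>v\<bar> * std_normal_density (v * s)) * indicator {-c..c} s"
      by (simp add: ennreal_mult indicator_def mult.assoc)
  qed
  finally show ?thesis .
qed

interpretation normal_pair: pair_prob_space std_normal_distribution std_normal_distribution ..

lemma emeasure_normal_cone_eq_nn_integral:
  "emeasure (std_normal_distribution \<Otimes>\<^sub>M std_normal_distribution) {z. \<bar>fst z\<bar> \<le> c * \<bar>snd z\<bar>}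
    = (\<integral>\<^sup>+v. ennreal (std_normal_density v)
        * emeasure std_normal_distribution {u. \<bar>u\<bar> \<le> c * \<bar>v\<bar>} \<partial>lborel)"
proof -
  let ?N = std_normal_distribution
  let ?cone = "{z :: real \<times> real. \<bar>fst z\<bar> \<le> c * \<bar>snd z\<bar>}"
  have "Measurable.pred (?N \<Otimes>\<^sub>M ?N) (\<lambda>z. \<bar>fst z\<bar> \<le> c * \<bar>snd z\<bar>)" by measurable
  then have cone: "?cone \<in> sets (?N \<Otimes>\<^sub>M ?N)" by (simp add: pred_def space_pair_measure)
  have "emeasure (?N \<Otimes>\<^sub>M ?N) ?cone = (\<integral>\<^sup>+v. emeasure ?N {u. \<bar>u\<bar> \<le> c * \<bar>v\<bar>} \<partial>?N)"
    using normal_pair.emeasure_pair_measure_alt2[OF cone] by (simp add: vimage_def)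
  also have "\<dots> = (\<integral>\<^sup>+v. ennreal (std_normal_density v) * emeasure ?N {u. \<bar>u\<bar> \<le> c * \<bar>v\<bar>} \<partial>lborel)"
    using normal_pair.measurable_emeasure_Pair2[OF cone]
    by (intro nn_integral_density) (simp_all add: vimage_def)
  finally show ?thesis .
qed

lemma emeasure_normal_cone:
  assumes "c \<ge> 0"
  shows "emeasure (std_normal_distribution \<Otimes>\<^sub>M std_normal_distribution) {z. \<bar>fst z\<bar> \<le> c * \<bar>snd z\<bar>}
    = ennreal (2 / pi * arctan c)"
proof -
  let ?f = "\<lambda>v s. ennreal (std_normal_density v * \<bar>v\<bar> * std_normal_density (v * s)) * indicator {-c..c} s"
  have "emeasure (std_normal_distribution \<Otimes>\<^sub>M std_normal_distribution) {z. \<bar>fst z\<bar> \<le> c * \<bar>snd z\<bar>}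
      = (\<integral>\<^sup>+v. (\<integral>\<^sup>+s. ?f v s \<partial>lborel) \<partial>lborel)"
    unfolding emeasure_normal_cone_eq_nn_integral
  proof (rule nn_integral_cong_AE)
    show "AE v in lborel. ennreal (std_normal_density v)
          * emeasure std_normal_distribution {u. \<bar>u\<bar> \<le> c * \<bar>v\<bar>}
        = (\<integral>\<^sup>+s. ?f v s \<partial>lborel)"
      using AE_lborel_singleton[of 0]
    proof eventually_elim
      case (elim v)
      show ?case
        by (subst emeasure_std_normal_abs_le[OF elim], subst nn_integral_cmult[symmetric])
           (auto simp: ennreal_mult mult.assoc)
    qed
  qed
  also have "\<dots> = (\<integral>\<^sup>+s. (\<integral>\<^sup>+v. ?f v s \<partial>lborel) \<partial>lborel)"
    by (rule lborel_pair.Fubini') simp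
  also have "\<dots> = (\<integral>\<^sup>+s. ennreal (1 / (pi * (1 + s\<^sup>2))) * indicator {-c..c} s \<partial>lborel)"
    by (subst nn_integral_multc) (auto simp: nn_integral_std_normal_product)
  also have "\<dots> = ennreal (2 / pi * arctan c)"
    by (rule nn_integral_Cauchy_density[OF assms])
  finally show ?thesis .
qed

lemma cdf_scaled_abs_normal_difference_0:
  assumes "0 < a" "0 \<le> b"
  shows "cdf (scaled_abs_normal a \<star> scaled_abs_normal (- b)) 0 = 2 / pi * arctan (b / a)"
proof -
  let ?N = std_normal_distribution
  have "scaled_abs_normal a \<star> scaled_abs_normal (- b)
      = distr (?N \<Otimes>\<^sub>M ?N) borel (\<lambda>z. a * \<bar>fst z\<bar> + (- b) * \<bar>snd z\<bar>)"
    unfolding scaled_abs_normal_def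
    by (rule convolution_distr) (auto intro: std_normal.prob_space_axioms)
  then have "cdf (scaled_abs_normal a \<star> scaled_abs_normal (- b)) 0
      = measure (?N \<Otimes>\<^sub>M ?N) {z \<in> space (?N \<Otimes>\<^sub>M ?N). a * \<bar>fst z\<bar> + (- b) * \<bar>snd z\<bar> \<le> 0}"
    by (simp only:) (rule normal_pair.cdf_distr, simp)
  also have "{z \<in> space (?N \<Otimes>\<^sub>M ?N). a * \<bar>fst z\<bar> + (- b) * \<bar>snd z\<bar> \<le> 0}
      = {z. \<bar>fst z\<bar> \<le> b / a * \<bar>snd z\<bar>}"
    using assms by (auto simp: space_pair_measure field_simps)
  also have "measure (?N \<Otimes>\<^sub>M ?N) \<dots> = 2 / pi * arctan (b / a)"
    unfolding measure_def using assms by (subst emeasure_normal_cone) (auto simp: zero_le_arctan_iff)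
  finally show ?thesis .
qed

definition arcsine_distribution :: "real measure" where
  "arcsine_distribution =
    density lborel (\<lambda>x. ennreal (indicator {0<..<1} x / (pi * sqrt (x * (1 - x)))))"

lemma DERIV_arcsin_sqrt:
  assumes "0 < x" "x < 1"
  shows "DERIV (\<lambda>x. 2 / pi * arcsin (sqrt x)) x :> 1 / (pi * sqrt (x * (1 - x)))"
proof -
  have "-1 < sqrt x" "sqrt x < 1" using assms order_less_le_trans[of "-1" 0 "sqrt x"] by auto
  then have "DERIV (\<lambda>x. 2 / pi * arcsin (sqrt x)) x
      :> 2 / pi * (inverse (sqrt (1 - (sqrt x)\<^sup>2)) * (inverse (sqrt x) / 2))"
    using assms by (intro DERIV_cmult DERIV_chain2[OF DERIV_arcsin] DERIV_real_sqrt) auto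
  also have "2 / pi * (inverse (sqrt (1 - (sqrt x)\<^sup>2)) * (inverse (sqrt x) / 2))
      = 1 / (pi * sqrt (x * (1 - x)))"
    using assms unfolding real_sqrt_mult by (simp add: divide_simps)
  finally show ?thesis .
qed

lemma continuous_on_arcsin_sqrt: "continuous_on {0..1} (\<lambda>x. 2 / pi * arcsin (sqrt x))"
proof (intro continuous_intros ballI conjI)
  show "- 1 \<le> sqrt x" "sqrt x \<le> 1" if "x \<in> {0..1}" for x :: real
    using that order_trans[of "-1" 0 "sqrt x"] by auto
qed

lemma
  assumes "0 \<le> a" "a < b" "b \<le> 1"
  shows set_integrable_arcsine_density:
      "set_integrable lborel {a<..<b} (\<lambda>x. 1 / (pi * sqrt (x * (1 - x))))"
    and interval_integral_arcsine_density:
      "(LBINT x=a..b. 1 / (pi * sqrt (x * (1 - x)))) = 2 / pi * arcsin (sqrt b) - 2 / pi * arcsin (sqrt a)"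
proof -
  let ?F = "\<lambda>x. 2 / pi * arcsin (sqrt x)"
  have "continuous_on {a..b} ?F"
    using assms by (intro continuous_on_subset[OF continuous_on_arcsin_sqrt]) auto
  then have "(?F \<longlongrightarrow> ?F a) (at a within {a..b})" "(?F \<longlongrightarrow> ?F b) (at b within {a..b})"
    using assms by (auto simp: continuous_on_def)
  then have "((?F \<circ> real_of_ereal) \<longlongrightarrow> ?F a) (at_right (ereal a))"
    "((?F \<circ> real_of_ereal) \<longlongrightarrow> ?F b) (at_left (ereal b))"
    using assms by (simp_all add: ereal_tendsto_simps at_within_Icc_at_right at_within_Icc_at_left)
  moreover have "isCont (\<lambda>x. 1 / (pi * sqrt (x * (1 - x)))) x" if "a < x" "x < b" for x
    using that assms by (intro continuous_intros) auto
  moreover have "DERIV ?F x :> 1 / (pi * sqrt (x * (1 - x)))" if "a < x" "x < b" for x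
    using that assms by (intro DERIV_arcsin_sqrt) auto
  ultimately show "set_integrable lborel {a<..<b} (\<lambda>x. 1 / (pi * sqrt (x * (1 - x))))"
    "(LBINT x=a..b. 1 / (pi * sqrt (x * (1 - x)))) = ?F b - ?F a"
    using assms interval_integral_FTC_nonneg[of "ereal a" "ereal b" ?F
      "\<lambda>x. 1 / (pi * sqrt (x * (1 - x)))" "?F a" "?F b"]
    by auto
qed

lemma emeasure_arcsine_distribution_Ioo:
  assumes "0 \<le> a" "a < b" "b \<le> 1"
  shows "emeasure arcsine_distribution {a<..<b} = ennreal (LBINT x=a..b. 1 / (pi * sqrt (x * (1 - x))))"
proof -
  have "emeasure arcsine_distribution {a<..<b}
      = (\<integral>\<^sup>+x. ennreal (indicator {a<..<b} x *\<^sub>R (1 / (pi * sqrt (x * (1 - x))))) \<partial>lborel)"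
    unfolding arcsine_distribution_def using assms
    by (subst emeasure_density) (auto intro!: nn_integral_cong simp: indicator_def)
  also have "\<dots> = ennreal (LBINT x:{a<..<b}. 1 / (pi * sqrt (x * (1 - x))))"
    unfolding set_lebesgue_integral_def
    using set_integrable_arcsine_density[OF assms] assms unfolding set_integrable_def
    by (intro nn_integral_eq_integral) (auto simp: indicator_def)
  finally show ?thesis using assms by (simp add: interval_lebesgue_integral_def)
qed

lemma real_distribution_arcsine: "real_distribution arcsine_distribution"
proof -
  have "emeasure arcsine_distribution UNIV = emeasure arcsine_distribution {0<..<1}"
    unfolding arcsine_distribution_def
    by (simp add: emeasure_density) (auto intro!: nn_integral_cong simp: indicator_def)
  also have "\<dots> = 1"
    using interval_integral_arcsine_density[of 0 1]
    by (simp add: emeasure_arcsine_distribution_Ioo zero_ereal_def one_ereal_def)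
  finally show ?thesis
    by (auto simp: real_distribution_def real_distribution_axioms_def arcsine_distribution_def
      intro!: prob_spaceI)
qed

interpretation arcsine: real_distribution arcsine_distribution
  by (rule real_distribution_arcsine)

lemma measure_arcsine_distribution_Ioo:
  assumes "0 \<le> a" "a \<le> b" "b \<le> 1"
  shows "measure arcsine_distribution {a<..<b} = (LBINT x=a..b. 1 / (pi * sqrt (x * (1 - x))))"
proof (cases "a = b")
  case True
  then show ?thesis by (simp add: interval_integral_endpoints_same)
next
  case False
  have "0 \<le> (LBINT x=a..b. 1 / (pi * sqrt (x * (1 - x))))"
    using assms
    by (auto simp: interval_lebesgue_integral_def set_lebesgue_integral_def indicator_def intro!:
      integral_nonneg)
  then show ?thesis
    using False assms by (simp add: measure_def emeasure_arcsine_distribution_Ioo)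
qed

lemma isCont_cdf_arcsine: "isCont (cdf arcsine_distribution) x"
  using real_distribution_arcsine unfolding arcsine_distribution_def
  by (intro isCont_cdf_density_lborel) auto

lemma cdf_arcsine:
  assumes "0 < x" "x \<le> 1"
  shows "cdf arcsine_distribution x = 2 / pi * arcsin (sqrt x)"
proof -
  have "cdf arcsine_distribution x = measure arcsine_distribution {0<..<x}"
    unfolding cdf_def
  proof (rule arcsine.finite_measure_eq_AE)
    show "AE y in arcsine_distribution. (y \<in> {..x}) = (y \<in> {0<..<x})"
      unfolding arcsine_distribution_def using AE_lborel_singleton[of x]
      by (subst AE_density) (auto elim!: eventually_mono simp: indicator_def)
  qed auto
  then show ?thesis
    using assms interval_integral_arcsine_density[of 0 x]
    by (simp add: measure_arcsine_distribution_Ioo zero_ereal_def)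
qed

lemma cdf_scaled_abs_normal_difference_arcsine:
  assumes "0 < x" "x < 1"
  shows "cdf (scaled_abs_normal (sqrt x) \<star> scaled_abs_normal (- sqrt (1 - x))) 0
      = 1 - cdf arcsine_distribution x"
proof -
  define r where "r = sqrt x / sqrt (1 - x)"
  have r_pos: "0 < r" using assms by (simp add: r_def)
  have "arctan (1 / r) = pi / 2 - arctan r"
    using arctan_inverse[of r] r_pos by (simp add: sgn_real_def inverse_eq_divide)
  also have "arctan r = arcsin (sqrt x)"
    using assms arcsin_arctan[of "sqrt x"] order_less_le_trans[of "-1" 0 "sqrt x"] by (simp add: r_def)
  finally show ?thesis
    using assms cdf_scaled_abs_normal_difference_0[of "sqrt x" "sqrt (1 - x)"]
    by (simp add: r_def cdf_arcsine field_simps)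
qed

section \<open>The maximum of a centred random walk\<close>

lemma (in prob_space) prob_greater_tendsto_0:
  fixes f :: "'a \<Rightarrow> real"
  assumes [measurable]: "f \<in> borel_measurable M" and c_at_top: "filterlim c at_top F"
  shows "((\<lambda>n. \<P>(x in M. c n < f x)) \<longlongrightarrow> 0) F"
proof -
  interpret D: real_distribution "distr M borel f" by simp
  have "((\<lambda>n. 1 - cdf (distr M borel f) (c n)) \<longlongrightarrow> 1 - 1) F"
    by (intro tendsto_intros filterlim_compose[OF D.cdf_lim_at_top_prob c_at_top])
  moreover have "1 - cdf (distr M borel f) s = \<P>(x in M. s < f x)" for s
    using prob_neg[of "\<lambda>x. f x \<le> s"] by (simp add: cdf_distr not_le)
  ultimately show ?thesis by simp
qed

lemma (in prob_space) prob_greater_le_second_moment: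
  fixes f :: "'a \<Rightarrow> real"
  assumes [measurable]: "f \<in> borel_measurable M" and square_integrable: "integrable M (\<lambda>x. (f x)\<^sup>2)"
    and c_nonneg: "0 \<le> c"
  shows "c\<^sup>2 * \<P>(x in M. c < f x) \<le> expectation (\<lambda>x. (f x)\<^sup>2 * indicator {x \<in> space M. c < f x} x)"
proof -
  let ?A = "{x \<in> space M. c < f x}"
  have "c\<^sup>2 * prob ?A = expectation (\<lambda>x. c\<^sup>2 * indicator ?A x)" by simp
  also have "\<dots> \<le> expectation (\<lambda>x. (f x)\<^sup>2 * indicator ?A x)"
  proof (rule integral_mono)
    show "integrable M (\<lambda>x. c\<^sup>2 * indicator ?A x)"
      by (intro integrable_mult_right integrable_real_indicator) (auto simp: less_top[symmetric])
    show "integrable M (\<lambda>x. (f x)\<^sup>2 * indicator ?A x)"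
      using integrable_mult_indicator[OF _ square_integrable, of ?A] by (simp add: mult.commute)
    show "c\<^sup>2 * indicator ?A x \<le> (f x)\<^sup>2 * indicator ?A x" if "x \<in> space M" for x
      using c_nonneg by (auto simp: indicator_def power_mono)
  qed
  finally show ?thesis .
qed

lemma (in prob_space) truncated_second_moment_tendsto_0:
  fixes f :: "'a \<Rightarrow> real"
  assumes [measurable]: "f \<in> borel_measurable M" and square_integrable: "integrable M (\<lambda>x. (f x)\<^sup>2)"
    and c_at_top: "filterlim c at_top sequentially"
  shows "(\<lambda>n. expectation (\<lambda>x. (f x)\<^sup>2 * indicator {x \<in> space M. c n < f x} x)) \<longlonglongrightarrow> 0"
proof -
  let ?trunc = "\<lambda>n x. (f x)\<^sup>2 * indicator {x \<in> space M. c n < f x} x"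
  have "(\<lambda>n. expectation (?trunc n)) \<longlonglongrightarrow> expectation (\<lambda>x. 0)"
  proof (rule integral_dominated_convergence[where w = "\<lambda>x. (f x)\<^sup>2"])
    show "AE x in M. (\<lambda>n. ?trunc n x) \<longlonglongrightarrow> 0"
    proof (intro AE_I2 tendsto_eventually)
      fix x
      have "eventually (\<lambda>n. f x \<le> c n) sequentially"
        using c_at_top unfolding filterlim_at_top by blast
      then show "eventually (\<lambda>n. ?trunc n x = 0) sequentially"
        by eventually_elim auto
    qed
    show "AE x in M. norm (?trunc n x) \<le> (f x)\<^sup>2" for n
      by (intro AE_I2) (auto simp: indicator_def)
  qed (auto intro: square_integrable)
  then show ?thesis by simp
qed

lemma filterlim_mult_sqrt_at_top:
  assumes "e > 0"
  shows "filterlim (\<lambda>n. e * sqrt (real n)) at_top sequentially"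
  using assms by real_asymp

lemma (in prob_space) nat_mult_prob_greater_sqrt_tendsto_0:
  fixes f :: "'a \<Rightarrow> real"
  assumes f_measurable: "f \<in> borel_measurable M" and square_integrable: "integrable M (\<lambda>x. (f x)\<^sup>2)"
    and e_pos: "e > 0"
  shows "(\<lambda>n. real n * \<P>(x in M. e * sqrt n < f x)) \<longlonglongrightarrow> 0"
proof (rule tendsto_sandwich[where f = "\<lambda>_. 0"])
  let ?trunc = "\<lambda>n. expectation (\<lambda>x. (f x)\<^sup>2 * indicator {x \<in> space M. e * sqrt (real n) < f x} x)"
  have "real n * \<P>(x in M. e * sqrt n < f x) \<le> ?trunc n / e\<^sup>2" for n
    using prob_greater_le_second_moment[OF f_measurable square_integrable, of "e * sqrt n"] e_pos
    by (simp add: power_mult_distrib pos_le_divide_eq mult_ac)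
  then show "eventually (\<lambda>n. real n * \<P>(x in M. e * sqrt n < f x) \<le> ?trunc n / e\<^sup>2) sequentially"
    by simp
  have "(\<lambda>n. ?trunc n / e\<^sup>2) \<longlonglongrightarrow> 0 / e\<^sup>2"
    using e_pos
    by (intro tendsto_divide truncated_second_moment_tendsto_0[OF f_measurable square_integrable]
        filterlim_mult_sqrt_at_top) auto
  then show "(\<lambda>n. ?trunc n / e\<^sup>2) \<longlonglongrightarrow> 0" by simp
qed simp_all

lemma (in prob_space) measure_distr_greaterThan:
  fixes f :: "'a \<Rightarrow> real"
  assumes "f \<in> borel_measurable M"
  shows "measure (distr M borel f) {c<..} = \<P>(x in M. c < f x)"
  using assms by (subst measure_distr) (auto intro: arg_cong[where f = prob])

locale iid_sequence = prob_space M for M :: "'a measure" +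
  fixes X :: "nat \<Rightarrow> 'a \<Rightarrow> real" and \<mu> :: "real measure"
  assumes indep: "indep_vars (\<lambda>_. borel) X UNIV"
    and identically_distributed: "\<And>n. distr M borel (X n) = \<mu>"
begin

definition partial_sum :: "nat \<Rightarrow> 'a \<Rightarrow> real" where
  "partial_sum n x = (\<Sum>i<n. X i x)"

abbreviation max_partial_sum :: "nat \<Rightarrow> 'a \<Rightarrow> real" where
  "max_partial_sum n x \<equiv> running_max (\<lambda>i. partial_sum i x) n"

lemma X_measurable [measurable]: "X n \<in> borel_measurable M"
  using indep unfolding indep_vars_def2 by simp

lemma partial_sum_measurable [measurable]: "partial_sum n \<in> borel_measurable M"
  unfolding partial_sum_def[abs_def] by measurable

lemma max_partial_sum_measurable [measurable]: "max_partial_sum n \<in> borel_measurable M"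
  by (rule borel_measurable_running_max) measurable

lemma partial_sum_0 [simp]: "partial_sum 0 x = 0"
  by (simp add: partial_sum_def)

lemma max_partial_sum_nonneg: "0 \<le> max_partial_sum n x"
  using running_max_ge[of 0 n "\<lambda>i. partial_sum i x"] by simp

lemma partial_sum_diff: "k \<le> n \<Longrightarrow> partial_sum n x - partial_sum k x = (\<Sum>i\<in>{k..<n}. X i x)"
  by (simp add: partial_sum_def atLeast0LessThan[symmetric] sum_diff_nat_ivl)

lemma distr_sum_cong_card:
  assumes "card A = card B"
  shows "distr M borel (\<lambda>x. \<Sum>i\<in>A. X i x) = distr M borel (\<lambda>x. \<Sum>i\<in>B. X i x)"
proof (rule Levy_uniqueness)
  have "char (distr M borel (\<lambda>x. \<Sum>i\<in>A. X i x)) t = char \<mu> t ^ card A" for A t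
    by (subst char_distr_sum) (auto intro: indep_vars_subset[OF indep] simp: identically_distributed)
  then show "char (distr M borel (\<lambda>x. \<Sum>i\<in>A. X i x)) = char (distr M borel (\<lambda>x. \<Sum>i\<in>B. X i x))"
    by (simp add: fun_eq_iff assms)
qed auto

lemma prob_X_greater: "\<P>(x in M. c < X n x) = measure \<mu> {c<..}"
  using measure_distr_greaterThan[of "X n" c] by (simp add: identically_distributed)

lemma prob_increment_greater:
  assumes "k \<le> n"
  shows "\<P>(x in M. c < partial_sum n x - partial_sum k x) = \<P>(x in M. c < partial_sum (n - k) x)"
proof -
  have "distr M borel (\<lambda>x. partial_sum n x - partial_sum k x) = distr M borel (partial_sum (n - k))"
    unfolding partial_sum_diff[OF assms] unfolding partial_sum_def[abs_def]
    by (rule distr_sum_cong_card) simp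
  then show ?thesis
    using measure_distr_greaterThan[of "\<lambda>x. partial_sum n x - partial_sum k x" c]
      measure_distr_greaterThan[of "partial_sum (n - k)" c] by simp
qed

definition first_passage :: "real \<Rightarrow> nat \<Rightarrow> 'a set" where
  "first_passage c k = {x \<in> space M. c < partial_sum k x \<and> (\<forall>i<k. partial_sum i x \<le> c)}"

lemma first_passage_measurable [measurable]: "first_passage c k \<in> sets M"
  unfolding first_passage_def by measurable

lemma disjoint_first_passage: "disjoint_family (first_passage c)"
  unfolding disjoint_family_on_def first_passage_def
  by (auto simp: set_eq_iff) (metis linorder_neqE_nat not_le)

lemma UN_first_passage: "(\<Union>k\<le>n. first_passage c k) = {x \<in> space M. c < max_partial_sum n x}"
proof -
  have "(\<exists>k\<le>n. c < partial_sum k x \<and> (\<forall>i<k. partial_sum i x \<le> c)) \<longleftrightarrow> (\<exists>k\<le>n. c < partial_sum k x)" for x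
    using ex_least_nat_le[of "\<lambda>k. c < partial_sum k x"] by (meson le_trans not_le)
  moreover have "c < max_partial_sum n x \<longleftrightarrow> (\<exists>k\<le>n. c < partial_sum k x)" for x
    using running_max_le_iff[of "\<lambda>i. partial_sum i x" n c] by (auto simp: not_le[symmetric])
  ultimately show ?thesis by (simp add: first_passage_def set_eq_iff) blast
qed

lemma prob_max_partial_sum_greater:
  "\<P>(x in M. c < max_partial_sum n x) = (\<Sum>k\<le>n. prob (first_passage c k))"
  using disjoint_first_passage[of c]
  by (subst UN_first_passage[symmetric], subst finite_measure_finite_Union)
     (auto intro: disjoint_family_on_mono)

lemma prob_first_passage_increment:
  assumes "k \<le> n"
  shows "prob (first_passage c k \<inter> {x \<in> space M. e < partial_sum n x - partial_sum k x})
       = prob (first_passage c k) * \<P>(x in M. e < partial_sum (n - k) x)"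
proof -
  let ?past = "\<lambda>y :: nat \<Rightarrow> real. c < (\<Sum>l<k. y l) \<and> (\<forall>i<k. (\<Sum>l<i. y l) \<le> c)"
  let ?future = "\<lambda>y :: nat \<Rightarrow> real. e < (\<Sum>l\<in>{k..<n}. y l)"
  have [measurable]: "(\<lambda>y. \<Sum>l<i. y l :: real) \<in> borel_measurable (PiM {..<k} (\<lambda>_. borel))"
    if "i \<le> k" for i
    using that
    by (intro borel_measurable_sum[of "{..<i}" "\<lambda>l y. y l"] measurable_component_singleton) auto
  have past: "Measurable.pred (PiM {..<k} (\<lambda>_. borel)) ?past"
    by (intro pred_intros_logic pred_intros_finite) simp_all
  have future: "Measurable.pred (PiM {k..<n} (\<lambda>_. borel)) ?future"
    by measurable
  have past_eq: "?past (\<lambda>i\<in>{..<k}. X i x) \<longleftrightarrow> c < partial_sum k x \<and> (\<forall>i<k. partial_sum i x \<le> c)" for x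
    by (auto simp: partial_sum_def)
  have future_eq: "?future (\<lambda>i\<in>{k..<n}. X i x) \<longleftrightarrow> e < partial_sum n x - partial_sum k x" for x
    using assms by (simp add: partial_sum_diff)
  have "indep_var (PiM {..<k} (\<lambda>_. borel)) (\<lambda>x. \<lambda>i\<in>{..<k}. X i x)
      (PiM {k..<n} (\<lambda>_. borel)) (\<lambda>x. \<lambda>i\<in>{k..<n}. X i x)"
    by (rule indep_var_restrict[OF indep]) auto
  from prob_conj_indep_var[OF this past future]
  have "prob (first_passage c k \<inter> {x \<in> space M. e < partial_sum n x - partial_sum k x})
      = prob (first_passage c k) * \<P>(x in M. e < partial_sum n x - partial_sum k x)"
    unfolding past_eq future_eq first_passage_def by (simp add: Int_def conj_ac)
  then show ?thesis by (simp add: prob_increment_greater[OF assms])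
qed

lemma prob_max_partial_sum_le:
  assumes "\<And>m. m \<ge> m\<^sub>0 \<Longrightarrow> p \<le> \<P>(x in M. 0 < partial_sum m x)"
  shows "p * \<P>(x in M. c < max_partial_sum n x) \<le> \<P>(x in M. c < partial_sum (n + m\<^sub>0) x)"
proof -
  let ?E = "\<lambda>k. first_passage c k \<inter> {x \<in> space M. 0 < partial_sum (n + m\<^sub>0) x - partial_sum k x}"
  have "p * \<P>(x in M. c < max_partial_sum n x) = (\<Sum>k\<le>n. prob (first_passage c k) * p)"
    unfolding prob_max_partial_sum_greater by (simp add: sum_distrib_left mult.commute)
  also have "\<dots> \<le> (\<Sum>k\<le>n. prob (first_passage c k) * \<P>(x in M. 0 < partial_sum (n + m\<^sub>0 - k) x))"
    by (intro sum_mono mult_left_mono assms) auto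
  also have "\<dots> = (\<Sum>k\<le>n. prob (?E k))"
    by (intro sum.cong refl prob_first_passage_increment[symmetric]) auto
  also have "\<dots> = prob (\<Union>k\<le>n. ?E k)"
    using disjoint_first_passage[of c]
    by (intro finite_measure_finite_Union[symmetric]) (auto simp: disjoint_family_on_def)
  also have "\<dots> \<le> \<P>(x in M. c < partial_sum (n + m\<^sub>0) x)"
    by (intro finite_measure_mono) (auto simp: first_passage_def)
  finally show ?thesis .
qed

lemma partial_sum_greater_subset:
  assumes "0 \<le> c" "0 \<le> e"
  shows "{x \<in> space M. c + 2 * e < partial_sum n x} \<subseteq> (\<Union>i<n. {x \<in> space M. e < X i x})
    \<union> (\<Union>k\<le>n. first_passage c k \<inter> {x \<in> space M. e < partial_sum n x - partial_sum k x})"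
proof
  fix x assume x_exceeds: "x \<in> {x \<in> space M. c + 2 * e < partial_sum n x}"
  then have "c < max_partial_sum n x"
    using running_max_ge[of n n "\<lambda>i. partial_sum i x"] assms(2) by simp
  with x_exceeds obtain k where passage: "k \<le> n" "x \<in> first_passage c k"
    using UN_first_passage[of c n] by auto
  have "k \<noteq> 0" using passage(2) assms(1) by (intro notI) (simp add: first_passage_def)
  then obtain j where k_eq: "k = Suc j" by (cases k) auto
  have "partial_sum k x = partial_sum j x + X j x" by (simp add: partial_sum_def k_eq)
  moreover have "partial_sum j x \<le> c" using passage k_eq by (auto simp: first_passage_def)
  ultimately have "e < X j x \<or> e < partial_sum n x - partial_sum k x" using x_exceeds by auto
  then show "x \<in> (\<Union>i<n. {x \<in> space M. e < X i x})
      \<union> (\<Union>k\<le>n. first_passage c k \<inter> {x \<in> space M. e < partial_sum n x - partial_sum k x})"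
    using x_exceeds k_eq passage by auto
qed

lemma prob_max_partial_sum_ge:
  assumes small: "\<And>m. m \<le> n \<Longrightarrow> \<P>(x in M. e < partial_sum m x) \<le> p" and "0 \<le> c" "0 \<le> e"
  shows "\<P>(x in M. c + 2 * e < partial_sum n x)
    \<le> real n * measure \<mu> {e<..} + p * \<P>(x in M. c < max_partial_sum n x)"
proof -
  let ?step = "\<lambda>i. {x \<in> space M. e < X i x}"
  let ?E = "\<lambda>k. first_passage c k \<inter> {x \<in> space M. e < partial_sum n x - partial_sum k x}"
  have "\<P>(x in M. c + 2 * e < partial_sum n x) \<le> prob ((\<Union>i<n. ?step i) \<union> (\<Union>k\<le>n. ?E k))"
    by (intro finite_measure_mono partial_sum_greater_subset assms) auto
  also have "\<dots> \<le> prob (\<Union>i<n. ?step i) + prob (\<Union>k\<le>n. ?E k)"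
    by (intro measure_Un_le) auto
  also have "\<dots> \<le> (\<Sum>i<n. prob (?step i)) + (\<Sum>k\<le>n. prob (?E k))"
    by (intro add_mono measure_UNION_le) auto
  also have "(\<Sum>i<n. prob (?step i)) = real n * measure \<mu> {e<..}"
    by (simp add: prob_X_greater)
  also have "(\<Sum>k\<le>n. prob (?E k))
      = (\<Sum>k\<le>n. prob (first_passage c k) * \<P>(x in M. e < partial_sum (n - k) x))"
    by (intro sum.cong refl prob_first_passage_increment) auto
  also have "\<dots> \<le> (\<Sum>k\<le>n. prob (first_passage c k) * p)"
    by (intro sum_mono mult_left_mono small) auto
  also have "\<dots> = p * \<P>(x in M. c < max_partial_sum n x)"
    unfolding prob_max_partial_sum_greater by (simp add: sum_distrib_left mult.commute)
  finally show ?thesis by simp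
qed

end

locale centered_iid = iid_sequence +
  fixes \<sigma> :: real
  assumes mean_0: "(\<integral>x. x \<partial>\<mu>) = 0"
    and square_integrable: "integrable \<mu> (\<lambda>x. x\<^sup>2)"
    and second_moment: "(\<integral>x. x\<^sup>2 \<partial>\<mu>) = \<sigma>\<^sup>2"
    and \<sigma>_pos: "0 < \<sigma>"
begin

lemma square_integrable_X: "integrable M (\<lambda>x. (X n x)\<^sup>2)"
  using square_integrable integrable_distr_eq[of "X n" M borel "\<lambda>x. x\<^sup>2"]
  by (simp add: identically_distributed)

lemma central_limit:
  "weak_conv_m (\<lambda>n. distr M borel (\<lambda>x. partial_sum n x / (\<sigma> * sqrt n))) std_normal_distribution"
proof -
  have expectation_X: "expectation (\<lambda>x. f (X n x)) = (\<integral>x. f x \<partial>\<mu>)"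
    if "f \<in> borel_measurable borel" for f :: "real \<Rightarrow> real" and n
    using integral_distr[of "X n" M borel f] that by (simp add: identically_distributed)
  have "expectation (X n) = 0" "variance (X n) = \<sigma>\<^sup>2" for n
    using expectation_X[of "\<lambda>x. x" n] expectation_X[of "\<lambda>x. x\<^sup>2" n] by (simp_all add: mean_0 second_moment)
  then have "weak_conv_m (\<lambda>n. distr M borel (\<lambda>x. (\<Sum>i<n. X i x) / sqrt (n * \<sigma>\<^sup>2)))
      std_normal_distribution"
    by (intro central_limit_theorem_zero_mean[where \<mu> = \<mu>] indep \<sigma>_pos square_integrable_X
      identically_distributed)
  then show ?thesis
    using \<sigma>_pos by (simp add: partial_sum_def real_sqrt_mult mult.commute)
qed

lemma partial_sum_tail:
  assumes k_at_top: "filterlim k at_top sequentially" and u_lim: "u \<longlonglongrightarrow> t"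
  shows "(\<lambda>n. \<P>(x in M. u n * (\<sigma> * sqrt (k n)) < partial_sum (k n) x)) \<longlonglongrightarrow> 1 - \<Phi> t"
proof -
  let ?F = "\<lambda>n. cdf (distr M borel (\<lambda>x. partial_sum (k n) x / (\<sigma> * sqrt (k n))))"
  have "(\<lambda>n. ?F n (u n)) \<longlonglongrightarrow> \<Phi> t"
    by (intro weak_conv_m_tendsto_cdf weak_conv_m_subseq[OF central_limit k_at_top] isCont_cdf_std_normal
      u_lim)
       (auto intro: std_normal.real_distribution_axioms)
  then have "(\<lambda>n. 1 - ?F n (u n)) \<longlonglongrightarrow> 1 - \<Phi> t"
    by (intro tendsto_intros)
  moreover have "eventually (\<lambda>n. 1 - ?F n (u n)
      = \<P>(x in M. u n * (\<sigma> * sqrt (k n)) < partial_sum (k n) x)) sequentially"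
    using eventually_compose_filterlim[OF eventually_gt_at_top[of 0] k_at_top]
  proof eventually_elim
    case (elim n)
    then have "?F n (u n) = \<P>(x in M. partial_sum (k n) x \<le> u n * (\<sigma> * sqrt (k n)))"
      using \<sigma>_pos by (simp add: cdf_distr pos_divide_le_eq)
    then show ?case
      using prob_neg[of "\<lambda>x. partial_sum (k n) x \<le> u n * (\<sigma> * sqrt (k n))"] by (simp add: not_le)
  qed
  ultimately show ?thesis by (rule Lim_transform_eventually)
qed

lemma prob_partial_sum_pos_tendsto_half: "(\<lambda>n. \<P>(x in M. 0 < partial_sum n x)) \<longlonglongrightarrow> 1 / 2"
  using partial_sum_tail[of "\<lambda>n. n" "\<lambda>_. 0" 0] by (simp add: cdf_std_normal_0 filterlim_ident)

lemma eventually_prob_partial_sums_le: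
  assumes "p > 1/2" "e > 0"
  shows "eventually (\<lambda>n. \<forall>m\<le>n. \<P>(x in M. e * sqrt n < partial_sum m x) \<le> p) sequentially"
proof -
  have "eventually (\<lambda>m. \<P>(x in M. 0 < partial_sum m x) < p) sequentially"
    using prob_partial_sum_pos_tendsto_half assms(1) by (rule order_tendstoD)
  then obtain m\<^sub>0 where m\<^sub>0: "\<And>m. m \<ge> m\<^sub>0 \<Longrightarrow> \<P>(x in M. 0 < partial_sum m x) < p"
    by (auto simp: eventually_sequentially)
  have "eventually (\<lambda>n. \<P>(x in M. e * sqrt n < partial_sum m x) < p) sequentially" for m
    using assms by (intro order_tendstoD(2)[OF prob_greater_tendsto_0] filterlim_mult_sqrt_at_top) auto
  then have "eventually (\<lambda>n. \<forall>m\<in>{..<m\<^sub>0}. \<P>(x in M. e * sqrt n < partial_sum m x) < p) sequentially"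
    by (intro eventually_ball_finite) auto
  then show ?thesis
  proof eventually_elim
    case (elim n)
    show ?case
    proof (intro allI impI)
      fix m
      have "0 \<le> e * sqrt n" using assms by simp
      then have "\<P>(x in M. e * sqrt n < partial_sum m x) \<le> \<P>(x in M. 0 < partial_sum m x)"
        by (intro finite_measure_mono) auto
      then show "\<P>(x in M. e * sqrt n < partial_sum m x) \<le> p"
        using bspec[OF elim, of m] m\<^sub>0[of m] by (cases "m < m\<^sub>0") auto
    qed
  qed
qed

text \<open>The limit law of the maximum without Donsker's theorem or symmetry of the steps: after the first passage
  above the level the increment is positive with probability close to one half, so the maximum exceeds
  the level about twice as often as the end point. The first passage overshoots by at most one step,
  which is negligible by the second moment.\<close>

lemma eventually_prob_max_partial_sum_less:
  assumes "2 * (1 - \<Phi> t) < y"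
  shows "eventually (\<lambda>n. \<P>(x in M. t * (\<sigma> * sqrt n) < max_partial_sum n x) < y) sequentially"
proof -
  have "0 \<le> 2 * (1 - \<Phi> t)"
    using std_normal.cdf_bounded_prob[of t] by simp
  then have "y > 0" using assms by (rule le_less_trans)
  then obtain p where p_range: "(1 - \<Phi> t) / y < p" "p < 1/2"
    using assms dense[of "(1 - \<Phi> t) / y" "1/2"] by (auto simp: field_simps)
  have "1 - \<Phi> t < p * y"
    using \<open>y > 0\<close> p_range(1) by (simp add: pos_divide_less_eq)
  have "0 \<le> (1 - \<Phi> t) / y"
    using \<open>y > 0\<close> std_normal.cdf_bounded_prob[of t] by simp
  then have "p > 0" using p_range(1) by (rule le_less_trans)
  have "eventually (\<lambda>m. p < \<P>(x in M. 0 < partial_sum m x)) sequentially"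
    using prob_partial_sum_pos_tendsto_half p_range(2) by (rule order_tendstoD)
  then obtain m\<^sub>0 where m\<^sub>0: "\<And>m. m \<ge> m\<^sub>0 \<Longrightarrow> p \<le> \<P>(x in M. 0 < partial_sum m x)"
    unfolding eventually_sequentially by (meson less_imp_le)
  define u where "u n = t * (sqrt (real n) / sqrt (real (n + m\<^sub>0)))" for n :: nat
  have "(\<lambda>n. sqrt (real n) / sqrt (real (n + m\<^sub>0))) \<longlonglongrightarrow> 1" by real_asymp
  then have "u \<longlonglongrightarrow> t"
    unfolding u_def using tendsto_mult[OF tendsto_const[of t]] by fastforce
  then have "eventually (\<lambda>n. \<P>(x in M. u n * (\<sigma> * sqrt (n + m\<^sub>0)) < partial_sum (n + m\<^sub>0) x) < p * y)
      sequentially"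
    using \<open>_ < p * y\<close>
    by (intro order_tendstoD(2)[OF partial_sum_tail]) (auto intro: filterlim_add_const_nat_at_top)
  then show ?thesis using eventually_gt_at_top[of 0]
  proof eventually_elim
    case (elim n)
    then have level: "u n * (\<sigma> * sqrt (n + m\<^sub>0)) = t * (\<sigma> * sqrt n)" by (simp add: u_def)
    have "p * \<P>(x in M. t * (\<sigma> * sqrt n) < max_partial_sum n x)
        \<le> \<P>(x in M. t * (\<sigma> * sqrt n) < partial_sum (n + m\<^sub>0) x)"
      by (rule prob_max_partial_sum_le[OF m\<^sub>0])
    also have "\<dots> < p * y" using elim(1) unfolding level .
    finally show ?case using \<open>p > 0\<close> by simp
  qed
qed

lemma eventually_prob_max_partial_sum_greater_of_shifted_tail:
  assumes "t \<ge> 0" and e_pos: "e > 0" and p_gt_half: "p > 1/2" and y_less: "p * y < 1 - \<Phi> (t + 2 * e)"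
  shows "eventually (\<lambda>n. y < \<P>(x in M. t * (\<sigma> * sqrt n) < max_partial_sum n x)) sequentially"
proof -
  have "(\<lambda>n. \<P>(x in M. (t + 2 * e) * (\<sigma> * sqrt n) < partial_sum n x)
        - real n * measure \<mu> {(e * \<sigma>) * sqrt n<..})
      \<longlonglongrightarrow> (1 - \<Phi> (t + 2 * e)) - 0"
    using e_pos \<sigma>_pos square_integrable_X unfolding prob_X_greater[of _ 0, symmetric]
    by (intro tendsto_diff partial_sum_tail nat_mult_prob_greater_sqrt_tendsto_0 tendsto_const
      filterlim_ident) auto
  then have "eventually (\<lambda>n. p * y < \<P>(x in M. (t + 2 * e) * (\<sigma> * sqrt n) < partial_sum n x)
      - real n * measure \<mu> {(e * \<sigma>) * sqrt n<..}) sequentially"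
    using y_less by (intro order_tendstoD(1)) auto
  moreover have "eventually (\<lambda>n. \<forall>m\<le>n. \<P>(x in M. (e * \<sigma>) * sqrt n < partial_sum m x) \<le> p) sequentially"
    using e_pos \<sigma>_pos p_gt_half by (intro eventually_prob_partial_sums_le) auto
  ultimately show ?thesis
  proof eventually_elim
    case (elim n)
    have "t * (\<sigma> * sqrt n) + 2 * ((e * \<sigma>) * sqrt n) = (t + 2 * e) * (\<sigma> * sqrt n)"
      by (simp add: algebra_simps)
    then have "p * y < p * \<P>(x in M. t * (\<sigma> * sqrt n) < max_partial_sum n x)"
      using prob_max_partial_sum_ge[of n "(e * \<sigma>) * sqrt n" p "t * (\<sigma> * sqrt n)"] elim assms(1) e_pos \<sigma>_pos
      by simp
    then show ?case using p_gt_half by simp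
  qed
qed

lemma eventually_prob_max_partial_sum_greater:
  assumes "t \<ge> 0" and y_less: "y < 2 * (1 - \<Phi> t)"
  shows "eventually (\<lambda>n. y < \<P>(x in M. t * (\<sigma> * sqrt n) < max_partial_sum n x)) sequentially"
proof -
  have "((\<lambda>e. t + 2 * e) \<longlongrightarrow> t + 2 * 0) (at_right 0)"
    by (intro tendsto_intros)
  then have "((\<lambda>e. 1 - \<Phi> (t + 2 * e) - (1/2 + e) * y)
      \<longlongrightarrow> 1 - \<Phi> t - (1/2 + 0) * y) (at_right 0)"
    by (intro tendsto_intros isCont_tendsto_compose[OF isCont_cdf_std_normal]) simp
  then have "eventually (\<lambda>e. 0 < e \<and> 0 < 1 - \<Phi> (t + 2 * e) - (1/2 + e) * y) (at_right 0)"
    using y_less by (intro eventually_conj eventually_at_right_less order_tendstoD(1)) auto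
  then obtain e where "0 < e" "(1/2 + e) * y < 1 - \<Phi> (t + 2 * e)"
    by (auto dest: eventually_happens'[OF trivial_limit_at_right_real])
  then show ?thesis
    using assms(1)
    by (intro eventually_prob_max_partial_sum_greater_of_shifted_tail[where e = e and p = "1/2 + e"]) auto
qed

theorem max_partial_sum_weak_conv:
  "weak_conv_m (\<lambda>n. distr M borel (\<lambda>x. max_partial_sum n x / (\<sigma> * sqrt n))) (scaled_abs_normal 1)"
  unfolding weak_conv_m_def weak_conv_def
proof (intro allI impI)
  fix t
  let ?F = "\<lambda>n. cdf (distr M borel (\<lambda>x. max_partial_sum n x / (\<sigma> * sqrt n))) t"
  have cdf_eq: "?F n = 1 - \<P>(x in M. t * (\<sigma> * sqrt n) < max_partial_sum n x)" if "n > 0" for n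
    using that \<sigma>_pos prob_neg[of "\<lambda>x. max_partial_sum n x \<le> t * (\<sigma> * sqrt n)"]
    by (simp add: cdf_distr pos_divide_le_eq not_le)
  show "?F \<longlonglongrightarrow> cdf (scaled_abs_normal 1) t"
  proof (cases "t < 0")
    case True
    have "?F n = 0" if "n > 0" for n
    proof -
      have "t * (\<sigma> * sqrt n) < max_partial_sum n x" for x
        using True \<sigma>_pos that max_partial_sum_nonneg[of x n] mult_neg_pos[of t "\<sigma> * sqrt n"] by simp
      then show ?thesis using cdf_eq[OF that] by (simp add: prob_space)
    qed
    then show ?thesis
      using True
      by (intro tendsto_eventually) (auto simp: cdf_scaled_abs_normal_1 eventually_at_top_dense)
  next
    case False
    then have "(\<lambda>n. \<P>(x in M. t * (\<sigma> * sqrt n) < max_partial_sum n x)) \<longlonglongrightarrow> 2 * (1 - \<Phi> t)"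
      by (intro order_tendstoI eventually_prob_max_partial_sum_less
        eventually_prob_max_partial_sum_greater) auto
    then have "(\<lambda>n. 1 - \<P>(x in M. t * (\<sigma> * sqrt n) < max_partial_sum n x)) \<longlonglongrightarrow> 1 - 2 * (1 - \<Phi> t)"
      by (intro tendsto_intros)
    moreover have "eventually (\<lambda>n. 1 - \<P>(x in M. t * (\<sigma> * sqrt n) < max_partial_sum n x) = ?F n)
        sequentially"
      using eventually_gt_at_top[of 0] by eventually_elim (simp add: cdf_eq)
    ultimately show ?thesis
      using False by (simp add: cdf_scaled_abs_normal_1 Lim_transform_eventually)
  qed
qed

corollary rescaled_max_partial_sum_weak_conv:
  assumes x_pos: "x > 0" and m_ratio: "(\<lambda>n. real (m n) / real n) \<longlonglongrightarrow> x"
  shows "weak_conv_m (\<lambda>n. distr M borel (\<lambda>w. s * max_partial_sum (m n) w / (\<sigma> * sqrt n)))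
    (scaled_abs_normal (s * sqrt x))"
proof -
  have "eventually (\<lambda>n. real (m n) / real n * real n = real (m n)) sequentially"
    using eventually_gt_at_top[of 0] by eventually_elim auto
  then have "filterlim (\<lambda>n. real (m n)) at_top sequentially"
    using filterlim_tendsto_pos_mult_at_top[OF m_ratio x_pos filterlim_real_sequentially]
    by (rule iffD1[OF filterlim_cong[OF refl refl]])
  then have m_top: "filterlim m at_top sequentially"
    by (simp add: filterlim_sequentially_iff_filterlim_real)
  have "weak_conv_m (\<lambda>n. distr (distr M borel (\<lambda>w. max_partial_sum (m n) w / (\<sigma> * sqrt (m n)))) borel
        (\<lambda>y. s * sqrt (m n / n) * y + 0))
      (distr (scaled_abs_normal 1) borel (\<lambda>y. s * sqrt x * y + 0))"
    by (intro weak_conv_m_affine weak_conv_m_subseq[OF max_partial_sum_weak_conv m_top] tendsto_intros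
        m_ratio real_distribution_scaled_abs_normal real_distribution_distr) simp
  moreover have "s * sqrt (m n / n) * (max_partial_sum (m n) w / (\<sigma> * sqrt (m n)))
      = s * max_partial_sum (m n) w / (\<sigma> * sqrt n)" for n w
    by (cases "m n = 0") (auto simp: real_sqrt_divide running_max_def)
  ultimately show ?thesis
    by (simp add: distr_distr comp_def distr_mult_scaled_abs_normal)
qed

end

section \<open>The cluster\<close>

definition add_exit :: "int set \<Rightarrow> (nat \<Rightarrow> int) \<Rightarrow> int set" where
  "add_exit A f = (if \<exists>n. f n \<notin> A then insert (f (LEAST n. f n \<notin> A)) A else A)"

lemma cluster_Suc: "cluster \<omega> U (Suc n) = add_exit (cluster \<omega> U n) (walk \<omega> U (Suc n))"
  by (simp add: add_exit_def Let_def)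

declare cluster.simps(2) [simp del]

lemma first_exit_neighbour:
  fixes f :: "nat \<Rightarrow> int"
  assumes start: "f 0 \<in> {g..d}" and step: "\<And>m. \<bar>f (Suc m) - f m\<bar> \<le> 1" and exit: "\<exists>m. f m \<notin> {g..d}"
  shows "f (LEAST m. f m \<notin> {g..d}) \<in> {g - 1, d + 1}"
proof -
  define e where "e = (LEAST m. f m \<notin> {g..d})"
  have outside: "f e \<notin> {g..d}" unfolding e_def by (rule LeastI_ex[OF exit])
  with start obtain m where e_eq: "e = Suc m" by (cases e) auto
  have "f m \<in> {g..d}"
    using not_less_Least[of m "\<lambda>m. f m \<notin> {g..d}"] e_eq by (auto simp: e_def)
  then show ?thesis using outside step[of m] unfolding e_def[symmetric] e_eq by auto
qed

lemma add_exit_interval: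
  assumes "f 0 \<in> {g..d}" "\<And>m. \<bar>f (Suc m) - f m\<bar> \<le> 1"
  shows "add_exit {g..d} f \<in> {{g..d}, {g - 1..d}, {g..d + 1}}"
proof (cases "\<exists>m. f m \<notin> {g..d}")
  case True
  have "insert (g - 1) {g..d} = {g - 1..d}" "insert (d + 1) {g..d} = {g..d + 1}"
    using assms(1) by auto
  then show ?thesis
    using True first_exit_neighbour[OF assms True] by (auto simp: add_exit_def)
qed (simp add: add_exit_def)

lemma cluster_interval:
  obtains g d where "g \<le> 0" "0 \<le> d" "cluster \<omega> U n = {g..d}"
proof -
  have "\<exists>g d. g \<le> 0 \<and> 0 \<le> d \<and> cluster \<omega> U n = {g..d}"
  proof (induction n)
    case 0
    show ?case by (intro exI[of _ 0]) auto
  next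
    case (Suc n)
    then obtain g d where interval: "g \<le> 0" "0 \<le> d" "cluster \<omega> U n = {g..d}" by blast
    moreover have "g - 1 \<le> 0" "0 \<le> d + 1" using interval by auto
    moreover have "cluster \<omega> U (Suc n) \<in> {{g..d}, {g - 1..d}, {g..d + 1}}"
      unfolding cluster_Suc interval(3) using interval by (intro add_exit_interval) auto
    ultimately show ?case by blast
  qed
  then show ?thesis using that by blast
qed

lemma dright_interval: "cluster \<omega> U n = {g..d} \<Longrightarrow> g \<le> d \<Longrightarrow> dright \<omega> U n = d"
  by (simp add: dright_def) (intro Max_eqI, auto)

lemma cluster_mono: "m \<le> n \<Longrightarrow> cluster \<omega> U m \<subseteq> cluster \<omega> U n"
  by (rule lift_Suc_mono_le) (auto simp: cluster_Suc add_exit_def)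

lemma card_cluster:
  assumes exit: "\<forall>j g d. \<exists>m. walk \<omega> U j m \<notin> {g..d}"
  shows "card (cluster \<omega> U n) = Suc n"
proof (induction n)
  case (Suc n)
  obtain g d where interval: "cluster \<omega> U n = {g..d}" by (rule cluster_interval)
  have "\<exists>m. walk \<omega> U (Suc n) m \<notin> {g..d}" using exit by blast
  then show ?case
    using Suc interval LeastI_ex[of "\<lambda>m. walk \<omega> U (Suc n) m \<notin> {g..d}"]
    by (simp add: cluster_Suc add_exit_def)
qed simp

lemma cluster_member_first_hit:
  assumes "z \<in> cluster \<omega> U n" "z \<noteq> 0"
  obtains j m where "j < n" "z \<notin> cluster \<omega> U j" "walk \<omega> U (Suc j) m = z"
    "\<And>k. k < m \<Longrightarrow> walk \<omega> U (Suc j) k \<in> cluster \<omega> U j"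
proof -
  have "\<exists>j<n. z \<notin> cluster \<omega> U j \<and> z \<in> cluster \<omega> U (Suc j)"
    using assms ex_least_nat_less[of "\<lambda>j. z \<in> cluster \<omega> U j" n] by auto
  then obtain j where joins: "j < n" "z \<notin> cluster \<omega> U j" "z \<in> cluster \<omega> U (Suc j)" by blast
  then have "walk \<omega> U (Suc j) (LEAST m. walk \<omega> U (Suc j) m \<notin> cluster \<omega> U j) = z"
    by (auto simp: cluster_Suc add_exit_def split: if_splits)
  then show ?thesis using that[OF joins(1,2)] not_less_Least by blast
qed

section \<open>The walk stopped on leaving an interval\<close>

definition stopped_step :: "(int \<Rightarrow> real) \<Rightarrow> int \<Rightarrow> int \<Rightarrow> int \<Rightarrow> real \<Rightarrow> int" where
  "stopped_step \<omega> p q y u = (if p < y \<and> y < q then y + (if u < \<omega> y then 1 else -1) else y)"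

fun stopped :: "(int \<Rightarrow> real) \<Rightarrow> int \<Rightarrow> int \<Rightarrow> nat \<Rightarrow> nat \<Rightarrow> (nat \<times> nat \<Rightarrow> real) \<Rightarrow> int" where
  "stopped \<omega> p q j 0 U = 0"
| "stopped \<omega> p q j (Suc n) U = stopped_step \<omega> p q (stopped \<omega> p q j n U) (U (j, n))"

lemma stopped_eq_walk:
  "(\<And>k. k < m \<Longrightarrow> walk \<omega> U j k \<in> {p<..<q}) \<Longrightarrow> stopped \<omega> p q j m U = walk \<omega> U j m"
  by (induction m) (auto simp: stopped_step_def)

lemma stopped_range: "p \<le> 0 \<Longrightarrow> 0 \<le> q \<Longrightarrow> stopped \<omega> p q j n U \<in> {p..q}"
  by (induction n) (auto simp: stopped_step_def)

lemma stopped_absorbed: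
  assumes "stopped \<omega> p q j n U = z" "z \<notin> {p<..<q}" "n \<le> m"
  shows "stopped \<omega> p q j m U = z"
  using assms(3) by (induction m rule: dec_induct) (use assms in \<open>auto simp: stopped_step_def\<close>)

lemma stopped_cong:
  "(\<And>k. k < n \<Longrightarrow> U (j, k) = V (j, k)) \<Longrightarrow> stopped \<omega> p q j n U = stopped \<omega> p q j n V"
  by (induction n) auto

lemma cluster_endpoint_hit:
  assumes "p < 0" "0 < q" and endpoint: "cluster \<omega> U n \<inter> {p, q} = {z}"
  shows "\<exists>j<n. \<exists>m. stopped \<omega> p q (Suc j) m U = z"
proof -
  have "z \<in> cluster \<omega> U n" "z \<in> {p, q}" using endpoint by blast+
  then have "z \<noteq> 0" using assms(1,2) by auto
  with \<open>z \<in> cluster \<omega> U n\<close> obtain j m where not_yet: "j < n" "z \<notin> cluster \<omega> U j"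
    and hits: "walk \<omega> U (Suc j) m = z"
    and inside: "\<And>k. k < m \<Longrightarrow> walk \<omega> U (Suc j) k \<in> cluster \<omega> U j"
    by (rule cluster_member_first_hit) blast
  obtain g d where interval: "g \<le> 0" "0 \<le> d" "cluster \<omega> U j = {g..d}" by (rule cluster_interval)
  have "cluster \<omega> U j \<inter> {p, q} \<subseteq> {z}"
    using endpoint cluster_mono[of j n \<omega> U] not_yet(1) by auto
  then have "p \<notin> {g..d}" "q \<notin> {g..d}" using not_yet(2) unfolding interval(3) by auto
  then have "cluster \<omega> U j \<subseteq> {p<..<q}" using interval assms(1,2) by auto
  then have "stopped \<omega> p q (Suc j) m U = walk \<omega> U (Suc j) m"
    using inside by (intro stopped_eq_walk) blast
  then show ?thesis using not_yet hits by blast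
qed

lemma dright_endpoint_hit:
  assumes q_range: "0 < q" "q \<le> int n" and exit: "\<forall>j g d. \<exists>m. walk \<omega> U j m \<notin> {g..d}"
  defines "p \<equiv> q - 1 - int n"
  shows "\<exists>j<n. \<exists>m. stopped \<omega> p q (Suc j) m U = (if dright \<omega> U n < q then p else q)"
proof (rule cluster_endpoint_hit)
  obtain g d where interval: "g \<le> 0" "0 \<le> d" "cluster \<omega> U n = {g..d}" by (rule cluster_interval)
  have "nat (d + 1 - g) = Suc n" using card_cluster[OF exit, of n] by (simp add: interval(3))
  then have "g = d - int n" using interval(1,2) by linarith
  moreover have "dright \<omega> U n = d" using interval by (intro dright_interval[OF interval(3)]) simp
  ultimately show "cluster \<omega> U n \<inter> {p, q} = {if dright \<omega> U n < q then p else q}"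
    unfolding interval(3) p_def using q_range interval(1,2) by (cases "d < q") auto
qed (use q_range in \<open>auto simp: p_def\<close>)

abbreviation unif :: "real measure" where
  "unif \<equiv> uniform_measure lborel {0..1}"

abbreviation noise :: "(nat \<times> nat \<Rightarrow> real) measure" where
  "noise \<equiv> PiM UNIV (\<lambda>_. unif)"

lemma prob_space_unif: "prob_space unif"
  by (rule prob_space_uniform_measure) auto

interpretation noise: prob_space noise
  by (rule prob_space_PiM) (rule prob_space_unif)

lemma stopped_step_measurable [measurable]:
  "(\<lambda>u. stopped_step \<omega> p q y u) \<in> measurable borel (count_space UNIV)"
  unfolding stopped_step_def by measurable

lemma stopped_measurable:
  assumes "{j} \<times> {..<n} \<subseteq> K"
  shows "stopped \<omega> p q j n \<in> measurable (PiM K (\<lambda>_. unif)) (count_space UNIV)"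
  using assms
proof (induction n)
  case 0
  then show ?case by (simp add: stopped.simps(1)[abs_def])
next
  case (Suc n)
  have "(\<lambda>U. U (j, n)) \<in> borel_measurable (PiM K (\<lambda>_. unif))"
    using Suc.prems measurable_component_singleton[of "(j, n)" K "\<lambda>_. unif"]
    by (auto cong: measurable_cong_sets)
  then have step: "(\<lambda>U. stopped_step \<omega> p q y (U (j, n)))
      \<in> measurable (PiM K (\<lambda>_. unif)) (count_space UNIV)" for y
    by measurable
  have "stopped \<omega> p q j n \<in> measurable (PiM K (\<lambda>_. unif)) (count_space UNIV)"
    using Suc.prems by (intro Suc.IH) auto
  from measurable_compose_countable[OF step this] show ?case
    by (simp add: stopped.simps(2)[abs_def])
qed

lemma stopped_measurable_noise [measurable]: "stopped \<omega> p q j n \<in> measurable noise (count_space UNIV)"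
  by (rule stopped_measurable) simp

lemma integrable_stopped:
  fixes f :: "int \<Rightarrow> real"
  assumes "p \<le> 0" "0 \<le> q"
  shows "integrable noise (\<lambda>U. f (stopped \<omega> p q j n U))"
proof (rule noise.integrable_const_bound)
  show "AE U in noise. norm (f (stopped \<omega> p q j n U)) \<le> (\<Sum>y\<in>{p..q}. norm (f y))"
    using stopped_range[OF assms] by (intro AE_I2 member_le_sum) auto
qed simp

lemma prob_noise_less:
  assumes "0 \<le> c" "c \<le> 1"
  shows "\<P>(U in noise. U k < c) = c"
proof -
  have "measure unif {..<c} = measure (distr noise unif (\<lambda>U. U k)) {..<c}"
    by (subst distr_PiM_component) (auto intro: prob_space_unif)
  also have "\<dots> = \<P>(U in noise. U k < c)"
    by (subst measure_distr) (auto intro!: arg_cong[where f = noise.prob] measurable_component_singleton)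
  also have "measure unif {..<c} = c"
  proof -
    have "{0..1} \<inter> {..<c} = {0..<c}" using assms by auto
    then show ?thesis using assms
      by (subst measure_uniform_measure) auto
  qed
  finally show ?thesis by simp
qed

definition stopped_transition :: "(int \<Rightarrow> real) \<Rightarrow> int \<Rightarrow> int \<Rightarrow> (int \<Rightarrow> real) \<Rightarrow> int \<Rightarrow> real" where
  "stopped_transition \<omega> p q f y =
    (if p < y \<and> y < q then \<omega> y * f (y + 1) + (1 - \<omega> y) * f (y - 1) else f y)"

lemma expectation_stopped_step:
  assumes "0 \<le> \<omega> y" "\<omega> y \<le> 1"
  shows "noise.expectation (\<lambda>U. f (stopped_step \<omega> p q y (U k))) = stopped_transition \<omega> p q f y"
proof (cases "p < y \<and> y < q")
  case True
  have [measurable]: "(\<lambda>U. U k) \<in> borel_measurable noise"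
    using measurable_component_singleton[of k UNIV "\<lambda>_. unif"] by (auto cong: measurable_cong_sets)
  let ?up = "{U \<in> space noise. U k < \<omega> y}"
  have "noise.expectation (\<lambda>U. f (stopped_step \<omega> p q y (U k)))
      = noise.expectation (\<lambda>U. f (y - 1) + (f (y + 1) - f (y - 1)) * indicator ?up U)"
    using True by (intro Bochner_Integration.integral_cong) (auto simp: stopped_step_def)
  also have "\<dots> = f (y - 1) + (f (y + 1) - f (y - 1)) * \<omega> y"
    using prob_noise_less[OF assms, of k]
    by (subst Bochner_Integration.integral_add) (auto simp: noise.prob_space less_top[symmetric])
  finally show ?thesis using True by (simp add: stopped_transition_def algebra_simps)
qed (auto simp: stopped_step_def stopped_transition_def noise.prob_space)

lemma expectation_stopped_Suc:
  assumes start_inside: "p \<le> 0" "0 \<le> q" and \<omega>: "\<And>y. 0 \<le> \<omega> y \<and> \<omega> y \<le> 1"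
  shows "noise.expectation (\<lambda>U. f (stopped \<omega> p q j (Suc n) U))
    = noise.expectation (\<lambda>U. stopped_transition \<omega> p q f (stopped \<omega> p q j n U))"
proof -
  let ?past = "{j} \<times> {..<n}" and ?next = "{(j, n)}"
  let ?S = "PiM ?past (\<lambda>_. unif)" and ?T = "PiM ?next (\<lambda>_. unif)"
  let ?g = "\<lambda>z. f (stopped_step \<omega> p q (stopped \<omega> p q j n (fst z)) (snd z (j, n)))"
  have indep: "noise.indep_var ?S (\<lambda>U. \<lambda>i\<in>?past. U i) ?T (\<lambda>U. \<lambda>i\<in>?next. U i)"
    by (rule noise.indep_var_restrict[OF indep_vars_PiM_coordinates[OF prob_space_unif]]) auto
  have past: "stopped \<omega> p q j n (\<lambda>i\<in>?past. U i) = stopped \<omega> p q j n U" for U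
    by (rule stopped_cong) simp
  have last: "(\<lambda>v. v (j, n)) \<in> borel_measurable ?T"
    using measurable_component_singleton[of "(j, n)" ?next "\<lambda>_. unif"] by (auto cong: measurable_cong_sets)
  have g_measurable: "?g \<in> borel_measurable (?S \<Otimes>\<^sub>M ?T)"
  proof (rule measurable_compose_countable[where f = "\<lambda>y z. f (stopped_step \<omega> p q y (snd z (j, n)))"
        and g = "\<lambda>z. stopped \<omega> p q j n (fst z)"])
    have "(\<lambda>u. f (stopped_step \<omega> p q y u)) \<in> borel_measurable borel" for y by measurable
    from measurable_compose[OF measurable_snd measurable_compose[OF last this]]
    show "(\<lambda>z. f (stopped_step \<omega> p q y (snd z (j, n)))) \<in> borel_measurable (?S \<Otimes>\<^sub>M ?T)" for y .
    show "(\<lambda>z. stopped \<omega> p q j n (fst z)) \<in> measurable (?S \<Otimes>\<^sub>M ?T) (count_space UNIV)"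
      by (intro measurable_compose[OF measurable_fst stopped_measurable]) simp
  qed
  have "integrable noise (\<lambda>U. ?g (\<lambda>i\<in>?past. U i, \<lambda>i\<in>?next. U i))"
    using integrable_stopped[OF start_inside, of f \<omega> j "Suc n"] by (simp add: past)
  from noise.expectation_indep_var[OF indep g_measurable this] show ?thesis
    unfolding fst_conv snd_conv past using \<omega> by (simp add: expectation_stopped_step)
qed

lemma expectation_stopped_harmonic:
  assumes start_inside: "p \<le> 0" "0 \<le> q" and \<omega>: "\<And>y. 0 \<le> \<omega> y \<and> \<omega> y \<le> 1"
    and harmonic: "\<And>y. p < y \<Longrightarrow> y < q \<Longrightarrow> \<omega> y * f (y + 1) + (1 - \<omega> y) * f (y - 1) = f y"
  shows "noise.expectation (\<lambda>U. f (stopped \<omega> p q j n U)) = f 0"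
proof (induction n)
  case 0
  show ?case by (simp add: noise.prob_space)
next
  case (Suc n)
  have "stopped_transition \<omega> p q f = f" using harmonic by (auto simp: stopped_transition_def)
  with Suc show ?case
    using expectation_stopped_Suc[OF start_inside \<omega>, where f = f and j = j and n = n] by simp
qed

lemma prob_stopped_le_harmonic:
  assumes start_inside: "p \<le> 0" "0 \<le> q" and \<omega>: "\<And>y. 0 \<le> \<omega> y \<and> \<omega> y \<le> 1"
    and harmonic: "\<And>y. p < y \<Longrightarrow> y < q \<Longrightarrow> \<omega> y * f (y + 1) + (1 - \<omega> y) * f (y - 1) = f y"
    and nonneg: "\<And>y. y \<in> {p..q} \<Longrightarrow> 0 \<le> f y" and z_pos: "0 < f z"
  shows "\<P>(U in noise. stopped \<omega> p q j n U = z) \<le> f 0 / f z"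
proof -
  let ?hit = "{U \<in> space noise. stopped \<omega> p q j n U = z}"
  have "f z * noise.prob ?hit = noise.expectation (\<lambda>U. f z * indicator ?hit U)" by simp
  also have "\<dots> \<le> noise.expectation (\<lambda>U. f (stopped \<omega> p q j n U))"
    using nonneg stopped_range[OF start_inside]
    by (intro integral_mono integrable_stopped start_inside integrable_mult_right
      integrable_real_indicator)
       (auto simp: indicator_def less_top[symmetric])
  also have "\<dots> = f 0" by (rule expectation_stopped_harmonic[OF start_inside \<omega> harmonic])
  finally show ?thesis using z_pos by (simp add: pos_le_divide_eq mult.commute)
qed

lemma prob_stopped_hits_le:
  assumes absorbing: "z \<notin> {p<..<q}" and hit_le: "\<And>n. \<P>(U in noise. stopped \<omega> p q j n U = z) \<le> c"
  shows "\<P>(U in noise. \<exists>n. stopped \<omega> p q j n U = z) \<le> c"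
proof -
  let ?hit = "\<lambda>n. {U \<in> space noise. stopped \<omega> p q j n U = z}"
  have "(\<lambda>n. noise.prob (?hit n)) \<longlonglongrightarrow> noise.prob (\<Union>n. ?hit n)"
  proof (rule noise.finite_Lim_measure_incseq)
    show "incseq ?hit" unfolding incseq_def using stopped_absorbed[OF _ absorbing] by blast
  qed auto
  then have "noise.prob (\<Union>n. ?hit n) \<le> c"
    by (rule LIMSEQ_le_const2) (use hit_le in auto)
  also have "(\<Union>n. ?hit n) = {U \<in> space noise. \<exists>n. stopped \<omega> p q j n U = z}" by auto
  finally show ?thesis .
qed

lemma ex_stopped_transition_ge_add_1:
  assumes \<omega>: "\<And>y. 0 < \<omega> y \<and> \<omega> y < 1"
  obtains f where "\<And>y. 0 \<le> f y" "\<And>y. p < y \<Longrightarrow> y < q \<Longrightarrow> f y + 1 \<le> stopped_transition \<omega> p q f y"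
proof -
  define l where "l = 1 + (\<Sum>y\<in>{p<..<q}. 2 / \<omega> y)"
  define f where "f y = l ^ nat (y - p)" for y
  have "1 \<le> l" unfolding l_def using \<omega> by (simp add: sum_nonneg less_imp_le)
  have "f y + 1 \<le> stopped_transition \<omega> p q f y" if inside: "p < y" "y < q" for y
  proof -
    have "2 / \<omega> y \<le> (\<Sum>y\<in>{p<..<q}. 2 / \<omega> y)"
      using inside \<omega> by (intro member_le_sum) (auto simp: less_imp_le)
    then have "2 \<le> \<omega> y * l" using \<omega>[of y] by (simp add: l_def field_simps)
    then have "2 * f y \<le> \<omega> y * l * f y" using \<open>1 \<le> l\<close> by (intro mult_right_mono) (auto simp: f_def)
    moreover have "nat (y + 1 - p) = Suc (nat (y - p))" using inside by linarith
    then have "stopped_transition \<omega> p q f y = \<omega> y * l * f y + (1 - \<omega> y) * f (y - 1)"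
      using inside by (simp add: stopped_transition_def f_def)
    moreover have "1 \<le> f y" "0 \<le> (1 - \<omega> y) * f (y - 1)" using \<open>1 \<le> l\<close> \<omega>[of y] by (auto simp: f_def)
    ultimately show ?thesis by linarith
  qed
  then show ?thesis using that[of f] \<open>1 \<le> l\<close> by (simp add: f_def)
qed

lemma expectation_stopped_ge_prob_stays:
  assumes start_inside: "p \<le> 0" "0 \<le> q" and \<omega>: "\<And>y. 0 \<le> \<omega> y \<and> \<omega> y \<le> 1"
    and nonneg: "\<And>y. 0 \<le> f y"
    and gain: "\<And>y. p < y \<Longrightarrow> y < q \<Longrightarrow> f y + 1 \<le> stopped_transition \<omega> p q f y"
  shows "real n * \<P>(U in noise. \<forall>n. stopped \<omega> p q j n U \<in> {p<..<q})
    \<le> noise.expectation (\<lambda>U. f (stopped \<omega> p q j n U))"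
proof (induction n)
  case 0
  show ?case by (simp add: nonneg)
next
  case (Suc n)
  define stays where "stays = {U \<in> space noise. \<forall>n. stopped \<omega> p q j n U \<in> {p<..<q}}"
  have [measurable]: "stays \<in> sets noise" unfolding stays_def greaterThanLessThan_iff by measurable
  have "real (Suc n) * noise.prob stays
      \<le> noise.expectation (\<lambda>U. f (stopped \<omega> p q j n U)) + noise.expectation (indicator stays)"
    using Suc by (simp add: stays_def algebra_simps)
  also have "\<dots> = noise.expectation (\<lambda>U. f (stopped \<omega> p q j n U) + indicator stays U)"
    by (intro Bochner_Integration.integral_add[symmetric] integrable_stopped start_inside
      integrable_real_indicator)
       (auto simp: less_top[symmetric])
  also have "\<dots> \<le> noise.expectation (\<lambda>U. stopped_transition \<omega> p q f (stopped \<omega> p q j n U))"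
  proof (intro integral_mono Bochner_Integration.integrable_add integrable_stopped start_inside
    integrable_real_indicator)
    show "f (stopped \<omega> p q j n U) + indicator stays U \<le> stopped_transition \<omega> p q f (stopped \<omega> p q j n U)"
      for U
      using gain[of "stopped \<omega> p q j n U"] by (auto simp: stays_def indicator_def stopped_transition_def)
  qed (auto simp: less_top[symmetric])
  also have "\<dots> = noise.expectation (\<lambda>U. f (stopped \<omega> p q j (Suc n) U))"
    by (rule expectation_stopped_Suc[OF start_inside \<omega>, symmetric])
  finally show ?case by (simp add: stays_def)
qed

text \<open>A bounded function that gains at least \<open>1\<close> in expectation at each step taken inside the interval
  bounds the expected number of such steps, so the walk cannot stay inside forever.\<close>

lemma AE_stopped_exits:
  assumes start_inside: "p \<le> 0" "0 \<le> q" and \<omega>: "\<And>y. 0 < \<omega> y \<and> \<omega> y < 1"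
  shows "AE U in noise. \<exists>n. stopped \<omega> p q j n U \<notin> {p<..<q}"
proof -
  obtain f where nonneg: "\<And>y. 0 \<le> f y"
    and gain: "\<And>y. p < y \<Longrightarrow> y < q \<Longrightarrow> f y + 1 \<le> stopped_transition \<omega> p q f y"
    by (rule ex_stopped_transition_ge_add_1[where \<omega> = \<omega> and p = p and q = q, OF \<omega>]) (rule that)
  define stays where "stays = {U \<in> space noise. \<forall>n. stopped \<omega> p q j n U \<in> {p<..<q}}"
  have [measurable]: "stays \<in> sets noise" unfolding stays_def greaterThanLessThan_iff by measurable
  have bound: "real n * noise.prob stays \<le> (\<Sum>y\<in>{p..q}. f y)" for n
  proof -
    have "real n * noise.prob stays \<le> noise.expectation (\<lambda>U. f (stopped \<omega> p q j n U))"
      unfolding stays_def using \<omega> nonneg gain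
      by (intro expectation_stopped_ge_prob_stays start_inside) (auto simp: less_imp_le)
    also have "\<dots> \<le> (\<Sum>y\<in>{p..q}. f y)"
      using stopped_range[OF start_inside] nonneg
      by (intro noise.integral_le_const integrable_stopped start_inside AE_I2 member_le_sum) auto
    finally show ?thesis .
  qed
  have "noise.prob stays \<le> 0"
  proof (rule ccontr)
    assume "\<not> noise.prob stays \<le> 0"
    then obtain n :: nat where "(\<Sum>y\<in>{p..q}. f y) < real n * noise.prob stays"
      using reals_Archimedean3[of "noise.prob stays"] by auto
    then show False using bound[of n] by simp
  qed
  then have "AE U in noise. U \<notin> stays"
    by (simp add: measure_le_0_iff flip: noise.prob_eq_0)
  with AE_space show ?thesis by eventually_elim (auto simp: stays_def)
qed

lemma AE_walk_exits:
  assumes \<omega>: "\<And>y. 0 < \<omega> y \<and> \<omega> y < 1"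
  shows "AE U in noise. \<forall>j g d. \<exists>m. walk \<omega> U j m \<notin> {g..d}"
proof -
  have "AE U in noise. \<exists>m. walk \<omega> U j m \<notin> {g..d}" for j g d
  proof (cases "0 \<in> {g..d}")
    case True
    then have "AE U in noise. \<exists>n. stopped \<omega> (g - 1) (d + 1) j n U \<notin> {g - 1<..<d + 1}"
      using \<omega> by (intro AE_stopped_exits) auto
    then show ?thesis
    proof eventually_elim
      case (elim U)
      show ?case
      proof (rule ccontr)
        assume "\<nexists>m. walk \<omega> U j m \<notin> {g..d}"
        then have inside: "walk \<omega> U j m \<in> {g..d}" for m by blast
        have "walk \<omega> U j m \<in> {g - 1<..<d + 1}" for m using inside[of m] by simp
        then show False using elim stopped_eq_walk[of _ \<omega> U j "g - 1" "d + 1"] by metis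
      qed
    qed
  next
    case False
    then have "\<exists>m. walk \<omega> U j m \<notin> {g..d}" for U by (intro exI[of _ 0]) simp
    then show ?thesis by simp
  qed
  then show ?thesis by (simp add: AE_all_countable)
qed

text \<open>If the right end is below \<open>q\<close> after \<open>n\<close> particles, the left end has reached \<open>p = q - 1 - n\<close>, so one of the
  \<open>n\<close> walks hit \<open>p\<close> before \<open>q\<close>; otherwise one of them hit \<open>q\<close> before \<open>p\<close>.\<close>

lemma AE_dright_endpoint_hit:
  assumes \<omega>: "\<And>y. 0 < \<omega> y \<and> \<omega> y < 1" and q_range: "0 < q" "q \<le> int n"
  defines "p \<equiv> q - 1 - int n"
  shows "AE U in noise. \<exists>j<n. \<exists>m. stopped \<omega> p q (Suc j) m U = (if dright \<omega> U n < q then p else q)"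
  using AE_walk_exits[of \<omega>, OF \<omega>] unfolding p_def
  by eventually_elim (rule dright_endpoint_hit[OF q_range])

section \<open>Exit probabilities through the potential\<close>

definition log_ratio :: "real \<Rightarrow> real" where
  "log_ratio x = ln ((1 - x) / x)"

lemma log_ratio_measurable [measurable]: "log_ratio \<in> borel_measurable borel"
  unfolding log_ratio_def[abs_def] by measurable

definition potential :: "(int \<Rightarrow> real) \<Rightarrow> int \<Rightarrow> real" where
  "potential \<omega> y = (if 0 \<le> y then \<Sum>i<nat y. log_ratio (\<omega> (int i + 1))
     else - (\<Sum>i<nat (- y). log_ratio (\<omega> (- int i))))"

lemma potential_nat: "potential \<omega> (int k) = (\<Sum>i<k. log_ratio (\<omega> (int i + 1)))"
  by (simp add: potential_def)

lemma potential_uminus_nat: "potential \<omega> (- int k) = (\<Sum>i<k. - log_ratio (\<omega> (- int i)))"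
  by (cases "k = 0") (simp_all add: potential_def sum_negf)

lemma potential_step: "potential \<omega> y = potential \<omega> (y - 1) + log_ratio (\<omega> y)"
proof (cases "y \<ge> 1")
  case True
  define k where "k = nat (y - 1)"
  have y_eq: "y = int (Suc k)" "y - 1 = int k" using True by (auto simp: k_def)
  show ?thesis unfolding y_eq(2) unfolding y_eq(1) potential_nat by (simp add: add.commute)
next
  case False
  define k where "k = nat (- y)"
  have y_eq: "y = - int k" "y - 1 = - int (Suc k)" using False by (auto simp: k_def)
  show ?thesis unfolding y_eq(2) unfolding y_eq(1) potential_uminus_nat by simp
qed

lemma exp_potential_step:
  assumes "0 < \<omega> y" "\<omega> y < 1"
  shows "(1 - \<omega> y) * exp (potential \<omega> (y - 1)) = \<omega> y * exp (potential \<omega> y)"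
  using assms unfolding potential_step[of \<omega> y] by (simp add: exp_add log_ratio_def)

lemma harmonic_of_increments:
  assumes "0 < \<omega> y" "\<omega> y < 1"
    and "h (y + 1) - h y = c * exp (potential \<omega> y)" "h y - h (y - 1) = c * exp (potential \<omega> (y - 1))"
  shows "\<omega> y * h (y + 1) + (1 - \<omega> y) * h (y - 1) = h y"
proof -
  have "\<omega> y * (h (y + 1) - h y) = (1 - \<omega> y) * (h y - h (y - 1))"
    unfolding assms(3,4) using exp_potential_step[of \<omega> y, OF assms(1,2)] by (simp add: mult.left_commute)
  then show ?thesis by (simp add: algebra_simps)
qed

lemma prob_exit_left_le:
  assumes \<omega>: "\<And>y. 0 < \<omega> y \<and> \<omega> y < 1" and start_inside: "p < 0" "0 < q"
  shows "\<P>(U in noise. \<exists>n. stopped \<omega> p q j n U = p)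
    \<le> (\<Sum>x\<in>{0..<q}. exp (potential \<omega> x)) / (\<Sum>x\<in>{p..<q}. exp (potential \<omega> x))"
proof (intro prob_stopped_hits_le prob_stopped_le_harmonic)
  let ?h = "\<lambda>y. \<Sum>x\<in>{y..<q}. exp (potential \<omega> x)"
  have increment: "?h (y + 1) - ?h y = -1 * exp (potential \<omega> y)" if "y < q" for y
  proof -
    have "{y..<q} = insert y {y + 1..<q}" using that by auto
    then show ?thesis by simp
  qed
  show "\<omega> y * ?h (y + 1) + (1 - \<omega> y) * ?h (y - 1) = ?h y" if "p < y" "y < q" for y
    using that \<omega>[of y] increment[of y] increment[of "y - 1"]
    by (intro harmonic_of_increments[where c = "-1"]) auto
  show "0 < ?h p" using start_inside by (intro sum_pos) auto
qed (use start_inside \<omega> in \<open>auto simp: less_imp_le intro: sum_nonneg\<close>)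

lemma prob_exit_right_le:
  assumes \<omega>: "\<And>y. 0 < \<omega> y \<and> \<omega> y < 1" and start_inside: "p < 0" "0 < q"
  shows "\<P>(U in noise. \<exists>n. stopped \<omega> p q j n U = q)
    \<le> (\<Sum>x\<in>{p..<0}. exp (potential \<omega> x)) / (\<Sum>x\<in>{p..<q}. exp (potential \<omega> x))"
proof (intro prob_stopped_hits_le prob_stopped_le_harmonic)
  let ?h = "\<lambda>y. \<Sum>x\<in>{p..<y}. exp (potential \<omega> x)"
  have increment: "?h (y + 1) - ?h y = 1 * exp (potential \<omega> y)" if "p \<le> y" for y
  proof -
    have "{p..<y + 1} = insert y {p..<y}" using that by auto
    then show ?thesis by simp
  qed
  show "\<omega> y * ?h (y + 1) + (1 - \<omega> y) * ?h (y - 1) = ?h y" if "p < y" "y < q" for y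
    using that \<omega>[of y] increment[of y] increment[of "y - 1"]
    by (intro harmonic_of_increments[where c = 1]) auto
  show "0 < ?h q" using start_inside by (intro sum_pos) auto
qed (use start_inside \<omega> in \<open>auto simp: less_imp_le intro: sum_nonneg\<close>)

lemma sum_exp_ratio_le:
  fixes V :: "'a \<Rightarrow> real"
  assumes "finite B" "b \<in> B" and V_le: "\<And>x. x \<in> A \<Longrightarrow> V x \<le> a"
  shows "(\<Sum>x\<in>A. exp (V x)) / (\<Sum>x\<in>B. exp (V x)) \<le> real (card A) * exp (a - V b)"
proof -
  have "(\<Sum>x\<in>A. exp (V x)) \<le> real (card A) * exp a"
    using V_le by (intro sum_bounded_above) auto
  moreover have "exp (V b) \<le> (\<Sum>x\<in>B. exp (V x))"
    using assms(1,2) by (intro member_le_sum) auto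
  ultimately have "(\<Sum>x\<in>A. exp (V x)) / (\<Sum>x\<in>B. exp (V x)) \<le> real (card A) * exp a / exp (V b)"
    by (intro frac_le) (auto intro: sum_nonneg)
  then show ?thesis by (simp add: exp_diff)
qed

abbreviation max_right :: "(int \<Rightarrow> real) \<Rightarrow> nat \<Rightarrow> real" where
  "max_right \<omega> \<equiv> running_max (\<lambda>i. potential \<omega> (int i))"

abbreviation max_left :: "(int \<Rightarrow> real) \<Rightarrow> nat \<Rightarrow> real" where
  "max_left \<omega> \<equiv> running_max (\<lambda>i. potential \<omega> (- int i))"

definition barrier_difference :: "(int \<Rightarrow> real) \<Rightarrow> nat \<Rightarrow> nat \<Rightarrow> real" where
  "barrier_difference \<omega> q n = max_right \<omega> (q - 1) - max_left \<omega> (n + 1 - q)"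

lemma prob_le_of_hits:
  assumes "AE U in noise. U \<in> E \<longrightarrow> (\<exists>j<n. \<exists>m. stopped \<omega> p q (Suc j) m U = z)"
    and hit_le: "\<And>j. \<P>(U in noise. \<exists>m. stopped \<omega> p q j m U = z) \<le> c"
  shows "noise.prob E \<le> real n * c"
proof -
  let ?hit = "\<lambda>j. {U \<in> space noise. \<exists>m. stopped \<omega> p q (Suc j) m U = z}"
  have "noise.prob E \<le> noise.prob (\<Union>j<n. ?hit j)"
  proof (rule noise.finite_measure_mono_AE)
    show "AE U in noise. U \<in> E \<longrightarrow> U \<in> (\<Union>j<n. ?hit j)"
      using assms(1) AE_space by eventually_elim blast
  qed measurable
  also have "\<dots> \<le> (\<Sum>j<n. noise.prob (?hit j))" by (intro measure_UNION_le) auto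
  also have "\<dots> \<le> real n * c" using hit_le sum_bounded_above[of "{..<n}" _ c] by simp
  finally show ?thesis .
qed

lemma prob_le_square_mult_exp_barrier:
  assumes hit: "AE U in noise. U \<in> E \<longrightarrow> (\<exists>j<n. \<exists>m. stopped \<omega> p q (Suc j) m U = z)"
    and exit: "\<And>j. \<P>(U in noise. \<exists>m. stopped \<omega> p q j m U = z)
      \<le> (\<Sum>x\<in>A. exp (potential \<omega> x)) / (\<Sum>x\<in>{p..<q}. exp (potential \<omega> x))"
    and far_side: "card A \<le> n" "\<And>x. x \<in> A \<Longrightarrow> potential \<omega> x \<le> a" and b_mem: "b \<in> {p..<q}"
  shows "noise.prob E \<le> (real n)\<^sup>2 * exp (a - potential \<omega> b)"
proof -
  have "\<P>(U in noise. \<exists>m. stopped \<omega> p q j m U = z) \<le> real (card A) * exp (a - potential \<omega> b)" for j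
    using sum_exp_ratio_le[OF _ b_mem far_side(2)] by (intro order_trans[OF exit]) auto
  with hit have "noise.prob E \<le> real n * (real (card A) * exp (a - potential \<omega> b))"
    by (rule prob_le_of_hits)
  also have "\<dots> \<le> real n * (real n * exp (a - potential \<omega> b))"
    using far_side(1) by (intro mult_left_mono mult_right_mono) auto
  finally show ?thesis by (simp add: power2_eq_square mult.assoc)
qed

lemma quenched_dright_less:
  assumes \<omega>: "\<And>y. 0 < \<omega> y \<and> \<omega> y < 1" and q_range: "1 \<le> q" "q \<le> n"
  shows "\<P>(U in noise. dright \<omega> U n < int q) \<le> (real n)\<^sup>2 * exp (barrier_difference \<omega> q n)"
proof -
  define p where "p = int q - 1 - int n"
  obtain i where max_at: "i \<le> n + 1 - q" "max_left \<omega> (n + 1 - q) = potential \<omega> (- int i)"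
    by (rule running_max_attained)
  have "AE U in noise. \<exists>j<n. \<exists>m. stopped \<omega> p (int q) (Suc j) m U
      = (if dright \<omega> U n < int q then p else int q)"
    unfolding p_def using q_range by (intro AE_dright_endpoint_hit \<omega>) auto
  then have "AE U in noise. U \<in> {U \<in> space noise. dright \<omega> U n < int q}
      \<longrightarrow> (\<exists>j<n. \<exists>m. stopped \<omega> p (int q) (Suc j) m U = p)"
    by eventually_elim (simp split: if_split_asm)
  then show ?thesis
    unfolding barrier_difference_def max_at(2)
  proof (rule prob_le_square_mult_exp_barrier[where A = "{0..<int q}"])
    show "potential \<omega> x \<le> max_right \<omega> (q - 1)" if "x \<in> {0..<int q}" for x
      using that running_max_ge[of "nat x" "q - 1" "\<lambda>i. potential \<omega> (int i)"] by auto
  qed (use q_range max_at(1) prob_exit_left_le[of \<omega> p "int q", OF \<omega>] in \<open>auto simp: p_def\<close>)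
qed

lemma quenched_dright_ge:
  assumes \<omega>: "\<And>y. 0 < \<omega> y \<and> \<omega> y < 1" and q_range: "1 \<le> q" "q \<le> n"
  shows "\<P>(U in noise. \<not> dright \<omega> U n < int q) \<le> (real n)\<^sup>2 * exp (- barrier_difference \<omega> q n)"
proof -
  define p where "p = int q - 1 - int n"
  obtain i where max_at: "i \<le> q - 1" "max_right \<omega> (q - 1) = potential \<omega> (int i)"
    by (rule running_max_attained)
  have "AE U in noise. \<exists>j<n. \<exists>m. stopped \<omega> p (int q) (Suc j) m U
      = (if dright \<omega> U n < int q then p else int q)"
    unfolding p_def using q_range by (intro AE_dright_endpoint_hit \<omega>) auto
  then have "AE U in noise. U \<in> {U \<in> space noise. \<not> dright \<omega> U n < int q}
      \<longrightarrow> (\<exists>j<n. \<exists>m. stopped \<omega> p (int q) (Suc j) m U = int q)"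
    by eventually_elim (simp split: if_split_asm)
  then show ?thesis
    unfolding barrier_difference_def minus_diff_eq max_at(2)
  proof (rule prob_le_square_mult_exp_barrier[where A = "{p..<0}"])
    show "potential \<omega> x \<le> max_left \<omega> (n + 1 - q)" if "x \<in> {p..<0}" for x
      using that running_max_ge[of "nat (- x)" "n + 1 - q" "\<lambda>i. potential \<omega> (- int i)"] q_range
      by (auto simp: p_def)
  qed (use q_range max_at(1) prob_exit_right_le[of \<omega> p "int q", OF \<omega>] in \<open>auto simp: p_def\<close>)
qed

section \<open>The annealed law\<close>

lemma pred_add_exit_eq:
  fixes f :: "nat \<Rightarrow> 'a \<Rightarrow> int"
  assumes [measurable]: "\<And>m. f m \<in> measurable M (count_space UNIV)"
  shows "Measurable.pred M (\<lambda>z. add_exit A (\<lambda>m. f m z) = B)"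
proof -
  have "(\<lambda>z. f (LEAST m. f m z \<notin> A) z) \<in> measurable M (count_space UNIV)"
    by (rule measurable_compose_countable[OF assms]) measurable
  from measurable_compose[OF this, of "\<lambda>y. insert y A = B" "count_space UNIV"]
  have [measurable]: "Measurable.pred M (\<lambda>z. insert (f (LEAST m. f m z \<notin> A) z) A = B)" by simp
  have "add_exit A (\<lambda>m. f m z) = B \<longleftrightarrow>
      (if \<exists>m. f m z \<notin> A then insert (f (LEAST m. f m z \<notin> A) z) A = B else A = B)" for z
    by (simp add: add_exit_def)
  then show ?thesis by simp
qed

lemma eventually_index_in_range:
  fixes q :: "nat \<Rightarrow> nat"
  assumes "0 < x" "x < 1" "(\<lambda>n. real (q n) / real n) \<longlonglongrightarrow> x"
  shows "eventually (\<lambda>n. 1 \<le> q n \<and> q n \<le> n) sequentially"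
proof -
  have "eventually (\<lambda>n. 0 < real (q n) / real n \<and> real (q n) / real n < 1) sequentially"
    using order_tendstoD[OF assms(3)] assms(1,2) by (auto intro: eventually_conj)
  then show ?thesis
    using eventually_gt_at_top[of 0]
    by eventually_elim (auto simp: divide_less_eq zero_less_divide_iff)
qed

lemma
  fixes q :: "nat \<Rightarrow> nat"
  assumes x: "0 < x" "x < 1" and q: "(\<lambda>n. real (q n) / real n) \<longlonglongrightarrow> x"
  shows pred_index_tendsto: "(\<lambda>n. real (q n - 1) / real n) \<longlonglongrightarrow> x"
    and complementary_index_tendsto: "(\<lambda>n. real (n + 1 - q n) / real n) \<longlonglongrightarrow> 1 - x"
proof -
  have inverse_n: "(\<lambda>n. 1 / real n) \<longlonglongrightarrow> 0" by real_asymp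
  have "(\<lambda>n. real (q n) / real n - 1 / real n) \<longlonglongrightarrow> x"
    using tendsto_diff[OF q inverse_n] by simp
  moreover have "eventually (\<lambda>n. real (q n) / real n - 1 / real n = real (q n - 1) / real n)
      sequentially"
    using eventually_index_in_range[OF x q] by eventually_elim (simp add: of_nat_diff diff_divide_distrib)
  ultimately show "(\<lambda>n. real (q n - 1) / real n) \<longlonglongrightarrow> x"
    by (rule Lim_transform_eventually)
  have "(\<lambda>n. 1 + 1 / real n - real (q n) / real n) \<longlonglongrightarrow> 1 - x"
    using tendsto_diff[OF tendsto_add[OF tendsto_const inverse_n] q, of 1] by simp
  moreover have "eventually (\<lambda>n. 1 + 1 / real n - real (q n) / real n = real (n + 1 - q n) / real n)
      sequentially"
    using eventually_index_in_range[OF x q]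
    by eventually_elim (simp add: of_nat_diff diff_divide_distrib add_divide_distrib)
  ultimately show "(\<lambda>n. real (n + 1 - q n) / real n) \<longlonglongrightarrow> 1 - x"
    by (rule Lim_transform_eventually)
qed

lemma potential_restrict:
  assumes "{1..y} \<union> {y + 1..0} \<subseteq> A"
  shows "potential (restrict \<omega> A) y = potential \<omega> y"
  using assms by (auto simp: potential_def subset_iff intro!: sum.cong)

locale environment = real_distribution mu for mu
begin

abbreviation env :: "(int \<Rightarrow> real) measure" where
  "env \<equiv> PiM UNIV (\<lambda>_. mu)"

sublocale env: prob_space env
  by (rule prob_space_PiM) (rule prob_space_axioms)

sublocale annealed: pair_prob_space env noise ..

lemma annealed_space_eq: "annealed_space mu = env \<Otimes>\<^sub>M noise"
  by (simp add: annealed_space_def)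

lemma env_component_measurable [measurable]: "(\<lambda>z. fst z y) \<in> borel_measurable (env \<Otimes>\<^sub>M noise)"
  using measurable_compose[OF measurable_fst measurable_component_singleton[of y UNIV "\<lambda>_. mu"]]
  by (simp cong: measurable_cong_sets)

lemma noise_component_measurable [measurable]: "(\<lambda>z. snd z k) \<in> borel_measurable (env \<Otimes>\<^sub>M noise)"
  using measurable_compose[OF measurable_snd measurable_component_singleton[of k UNIV "\<lambda>_. unif"]]
  by (simp cong: measurable_cong_sets)

lemma walk_measurable [measurable]:
  "(\<lambda>z. walk (fst z) (snd z) j n) \<in> measurable (env \<Otimes>\<^sub>M noise) (count_space UNIV)"
proof (induction n)
  case (Suc n)
  have "(\<lambda>z. (\<lambda>y z. y + (if snd z (j, n) < fst z y then 1 else -1)) (walk (fst z) (snd z) j n) z)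
      \<in> measurable (env \<Otimes>\<^sub>M noise) (count_space UNIV)"
    by (rule measurable_compose_countable[OF _ Suc]) measurable
  then show ?case by simp
qed simp

lemma cluster_measurable [measurable]:
  "Measurable.pred (env \<Otimes>\<^sub>M noise) (\<lambda>z. cluster (fst z) (snd z) n = A)"
proof (induction n arbitrary: A)
  case (Suc n)
  note [measurable] = Suc pred_add_exit_eq[OF walk_measurable]
  have "cluster \<omega> U (Suc n) = A \<longleftrightarrow>
      (\<exists>g d. cluster \<omega> U n = {g..d} \<and> add_exit {g..d} (walk \<omega> U (Suc n)) = A)" for \<omega> U
    by (rule cluster_interval[of \<omega> U n]) (auto simp: cluster_Suc)
  then show ?case by simp
qed simp

lemma dright_measurable [measurable]:
  "(\<lambda>z. dright (fst z) (snd z) n) \<in> measurable (env \<Otimes>\<^sub>M noise) (count_space UNIV)"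
proof (subst measurable_count_space_eq2_countable, intro conjI ballI)
  fix d :: int
  have "dright \<omega> U n = d \<longleftrightarrow> (\<exists>g. g \<le> d \<and> cluster \<omega> U n = {g..d})" for \<omega> U
  proof
    assume "dright \<omega> U n = d"
    moreover obtain g d' where "g \<le> 0" "0 \<le> d'" "cluster \<omega> U n = {g..d'}" by (rule cluster_interval)
    ultimately show "\<exists>g. g \<le> d \<and> cluster \<omega> U n = {g..d}"
      using dright_interval[of \<omega> U n g d'] by auto
  qed (auto dest: dright_interval)
  then have "(\<lambda>z. dright (fst z) (snd z) n) -` {d} \<inter> space (env \<Otimes>\<^sub>M noise)
      = {z \<in> space (env \<Otimes>\<^sub>M noise). \<exists>g. g \<le> d \<and> cluster (fst z) (snd z) n = {g..d}}" by auto
  also have "\<dots> \<in> sets (env \<Otimes>\<^sub>M noise)" by measurable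
  finally show "(\<lambda>z. dright (fst z) (snd z) n) -` {d} \<inter> space (env \<Otimes>\<^sub>M noise) \<in> sets (env \<Otimes>\<^sub>M noise)" .
qed auto

lemma iid_sequence_coordinates:
  fixes f :: "real \<Rightarrow> real" and g :: "nat \<Rightarrow> int"
  assumes f_measurable: "f \<in> borel_measurable borel" and inj_g: "inj g"
  shows "iid_sequence env (\<lambda>i \<omega>. f (\<omega> (g i))) (distr mu borel f)"
proof (intro iid_sequence.intro env.prob_space_axioms iid_sequence_axioms.intro)
  have f_mu: "f \<in> borel_measurable mu" using f_measurable by simp
  have "env.indep_vars (\<lambda>j. PiM {g j} (\<lambda>_. mu)) (\<lambda>j \<omega>. restrict (\<lambda>i. \<omega> i) {g j}) UNIV"
    using inj_g by (intro env.indep_vars_restrict[OF indep_vars_PiM_coordinates])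
      (auto simp: prob_space_axioms disjoint_family_on_def inj_def)
  then have "env.indep_vars (\<lambda>_. borel) (\<lambda>j \<omega>. (\<lambda>u. f (u (g j))) (restrict (\<lambda>i. \<omega> i) {g j})) UNIV"
  proof (rule env.indep_vars_compose2)
    show "(\<lambda>u. f (u (g i))) \<in> borel_measurable (PiM {g i} (\<lambda>_. mu))" for i
      using measurable_compose[OF measurable_component_singleton[of "g i" "{g i}" "\<lambda>_. mu"] f_mu] by simp
  qed
  then show "env.indep_vars (\<lambda>_. borel) (\<lambda>i \<omega>. f (\<omega> (g i))) UNIV" by simp
  have "distr env mu (\<lambda>\<omega>. \<omega> i) = mu" for i
    by (rule distr_PiM_component) (auto intro: prob_space_axioms)
  then show "distr env borel (\<lambda>\<omega>. f (\<omega> (g n))) = distr mu borel f" for n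
    using distr_distr[OF f_mu measurable_component_singleton[of "g n" UNIV "\<lambda>_. mu"]]
    by (simp add: comp_def)
qed

lemma centered_iid_coordinates:
  fixes f :: "real \<Rightarrow> real" and g :: "nat \<Rightarrow> int"
  assumes f [measurable]: "f \<in> borel_measurable borel" and "inj g" and "0 < \<sigma>"
    and "expectation f = 0" "integrable mu (\<lambda>x. (f x)\<^sup>2)" "expectation (\<lambda>x. (f x)\<^sup>2) = \<sigma>\<^sup>2"
  shows "centered_iid env (\<lambda>i \<omega>. f (\<omega> (g i))) (distr mu borel f) \<sigma>"
  using assms
  by (intro centered_iid.intro centered_iid_axioms.intro iid_sequence_coordinates)
     (simp_all add: integral_distr integrable_distr_eq)

lemma potential_measurable:
  assumes "{1..y} \<union> {y + 1..0} \<subseteq> A"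
  shows "(\<lambda>\<omega>. potential \<omega> y) \<in> borel_measurable (PiM A (\<lambda>_. mu))"
proof -
  have "log_ratio \<in> borel_measurable mu" by simp
  then have "(\<lambda>\<omega>. log_ratio (\<omega> i)) \<in> borel_measurable (PiM A (\<lambda>_. mu))" if "i \<in> A" for i
    using that by (intro measurable_compose[OF measurable_component_singleton])
  then show ?thesis
    unfolding potential_def using assms
    by (cases "0 \<le> y") (auto simp: subset_iff intro!: borel_measurable_sum borel_measurable_uminus)
qed

lemma indep_max_right_max_left:
  "env.indep_var borel (\<lambda>\<omega>. max_right \<omega> k) borel (\<lambda>\<omega>. max_left \<omega> l)"
proof -
  let ?R = "{1::int..}" and ?L = "{..0::int}"
  have "env.indep_var (PiM ?R (\<lambda>_. mu)) (\<lambda>\<omega>. restrict (\<lambda>i. \<omega> i) ?R)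
      (PiM ?L (\<lambda>_. mu)) (\<lambda>\<omega>. restrict (\<lambda>i. \<omega> i) ?L)"
    by (rule env.indep_var_restrict[OF indep_vars_PiM_coordinates]) (auto simp: prob_space_axioms)
  then have "env.indep_var borel ((\<lambda>u. max_right u k) \<circ> (\<lambda>\<omega>. restrict (\<lambda>i. \<omega> i) ?R))
      borel ((\<lambda>u. max_left u l) \<circ> (\<lambda>\<omega>. restrict (\<lambda>i. \<omega> i) ?L))"
    by (rule env.indep_var_compose) (auto intro!: borel_measurable_running_max potential_measurable)
  moreover have "max_right (restrict \<omega> ?R) k = max_right \<omega> k" "max_left (restrict \<omega> ?L) l = max_left \<omega> l"
    for \<omega>
    by (simp_all add: potential_restrict)
  ultimately show ?thesis by (simp add: comp_def)
qed

lemma barrier_difference_measurable [measurable]: "(\<lambda>\<omega>. barrier_difference \<omega> q n) \<in> borel_measurable env"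
  unfolding barrier_difference_def
  by (intro borel_measurable_diff borel_measurable_running_max potential_measurable) auto

lemma annealed_prob_le_quenched:
  assumes Q_pred: "Measurable.pred (env \<Otimes>\<^sub>M noise) (\<lambda>z. Q (fst z) (snd z))"
    and [measurable]: "h \<in> borel_measurable env" and "0 \<le> K"
    and quenched_le: "AE \<omega> in env. \<P>(U in noise. Q \<omega> U) \<le> K * exp (h \<omega>)"
  shows "\<P>(z in env \<Otimes>\<^sub>M noise. Q (fst z) (snd z)) \<le> \<P>(\<omega> in env. - c < h \<omega>) + K * exp (- c)"
proof (rule annealed.prob_le_section)
  let ?Z = "{z \<in> space (env \<Otimes>\<^sub>M noise). Q (fst z) (snd z)}"
  show "?Z \<in> sets (env \<Otimes>\<^sub>M noise)" using Q_pred by (simp add: pred_def)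
  show "AE \<omega> in env. \<omega> \<notin> {\<omega> \<in> space env. - c < h \<omega>} \<longrightarrow> noise.prob (Pair \<omega> -` ?Z) \<le> K * exp (- c)"
    using quenched_le AE_space
  proof eventually_elim
    case (elim \<omega>)
    have "Pair \<omega> -` ?Z = {U \<in> space noise. Q \<omega> U}"
      using elim(2) by (auto simp: space_pair_measure)
    moreover have "K * exp (h \<omega>) \<le> K * exp (- c)" if "h \<omega> \<le> - c"
      using that \<open>0 \<le> K\<close> by (intro mult_left_mono) auto
    ultimately show ?case using elim by (auto simp: not_less intro: order_trans)
  qed
qed (use \<open>0 \<le> K\<close> in auto)

end

locale sinai_environment = environment +
  assumes elliptic: "AE x in mu. 0 < x \<and> x < 1"
    and mean_zero: "expectation log_ratio = 0"
    and square_integrable: "integrable mu (\<lambda>x. (log_ratio x)\<^sup>2)"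
    and nondegenerate: "0 < expectation (\<lambda>x. (log_ratio x)\<^sup>2)"
begin

definition \<sigma> :: real where
  "\<sigma> = sqrt (expectation (\<lambda>x. (log_ratio x)\<^sup>2))"

lemma \<sigma>_pos: "0 < \<sigma>"
  using nondegenerate by (simp add: \<sigma>_def)

lemma \<sigma>_square: "expectation (\<lambda>x. (log_ratio x)\<^sup>2) = \<sigma>\<^sup>2"
  using nondegenerate by (simp add: \<sigma>_def)

sublocale R: centered_iid env "\<lambda>i \<omega>. log_ratio (\<omega> (int i + 1))" "distr mu borel log_ratio" \<sigma>
  using mean_zero square_integrable \<sigma>_square \<sigma>_pos by (intro centered_iid_coordinates) (auto simp: inj_def)

sublocale L: centered_iid env "\<lambda>i \<omega>. - log_ratio (\<omega> (- int i))" "distr mu borel (\<lambda>x. - log_ratio x)" \<sigma>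
  using mean_zero square_integrable \<sigma>_square \<sigma>_pos
  by (intro centered_iid_coordinates[of "\<lambda>x. - log_ratio x"]) (auto simp: inj_def)

lemma potential_eq_partial_sum:
  "potential \<omega> (int k) = R.partial_sum k \<omega>" "potential \<omega> (- int k) = L.partial_sum k \<omega>"
  by (simp_all add: potential_nat potential_uminus_nat R.partial_sum_def L.partial_sum_def)

lemma barrier_difference_weak_conv:
  fixes q :: "nat \<Rightarrow> nat"
  assumes x_range: "0 < x" "x < 1" and q_ratio: "(\<lambda>n. real (q n) / real n) \<longlonglongrightarrow> x"
  shows "weak_conv_m (\<lambda>n. distr env borel (\<lambda>\<omega>. barrier_difference \<omega> (q n) n / (\<sigma> * sqrt n)))
    (scaled_abs_normal (sqrt x) \<star> scaled_abs_normal (- sqrt (1 - x)))"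
proof -
  let ?X = "\<lambda>n \<omega>. 1 * max_right \<omega> (q n - 1) / (\<sigma> * sqrt n)"
  let ?Y = "\<lambda>n \<omega>. -1 * max_left \<omega> (n + 1 - q n) / (\<sigma> * sqrt n)"
  have indep: "env.indep_var borel (?X n) borel (?Y n)" for n
    using env.indep_var_compose[OF indep_max_right_max_left,
        of "\<lambda>y. 1 * y / (\<sigma> * sqrt n)" borel "\<lambda>y. -1 * y / (\<sigma> * sqrt n)" borel]
    by (simp add: comp_def)
  note X_measurable = env.indep_var_rv1[OF indep] and Y_measurable = env.indep_var_rv2[OF indep]
  have "distr env borel (\<lambda>\<omega>. ?X n \<omega> + ?Y n \<omega>) = (distr env borel (?X n) \<star> distr env borel (?Y n))" for n
    by (rule env.sum_indep_random_variable[OF indep X_measurable Y_measurable])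
  moreover have "?X n \<omega> + ?Y n \<omega> = barrier_difference \<omega> (q n) n / (\<sigma> * sqrt n)" for n \<omega>
    by (simp add: barrier_difference_def diff_divide_distrib)
  moreover have "weak_conv_m (\<lambda>n. distr env borel (?X n)) (scaled_abs_normal (1 * sqrt x))"
    unfolding potential_eq_partial_sum
    by (rule R.rescaled_max_partial_sum_weak_conv[OF x_range(1) pred_index_tendsto[OF x_range q_ratio]])
  moreover have "weak_conv_m (\<lambda>n. distr env borel (?Y n)) (scaled_abs_normal (-1 * sqrt (1 - x)))"
    unfolding potential_eq_partial_sum
    using x_range(2)
    by (intro L.rescaled_max_partial_sum_weak_conv complementary_index_tendsto[OF x_range q_ratio]) simp
  ultimately show ?thesis
    using weak_conv_m_convolution[of "\<lambda>n. distr env borel (?X n)" "scaled_abs_normal (1 * sqrt x)"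
        "\<lambda>n. distr env borel (?Y n)" "scaled_abs_normal (-1 * sqrt (1 - x))"]
      env.real_distribution_distr[OF X_measurable] env.real_distribution_distr[OF Y_measurable]
    by (simp add: real_distribution_scaled_abs_normal)
qed

lemma barrier_difference_limit:
  fixes q :: "nat \<Rightarrow> nat"
  assumes x_range: "0 < x" "x < 1" and q_ratio: "(\<lambda>n. real (q n) / real n) \<longlonglongrightarrow> x" and s_lim: "s \<longlonglongrightarrow> 0"
  shows "(\<lambda>n. \<P>(\<omega> in env. barrier_difference \<omega> (q n) n \<le> s n * (\<sigma> * sqrt n)))
      \<longlonglongrightarrow> 1 - cdf arcsine_distribution x"
proof (rule Lim_transform_eventually)
  let ?D = "\<lambda>n \<omega>. barrier_difference \<omega> (q n) n / (\<sigma> * sqrt n)"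
  show "(\<lambda>n. cdf (distr env borel (?D n)) (s n)) \<longlonglongrightarrow> 1 - cdf arcsine_distribution x"
    unfolding cdf_scaled_abs_normal_difference_arcsine[OF x_range, symmetric]
  proof (rule weak_conv_m_tendsto_cdf[OF _ _ barrier_difference_weak_conv[OF x_range q_ratio] _ s_lim])
    show "isCont (cdf (scaled_abs_normal (sqrt x) \<star> scaled_abs_normal (- sqrt (1 - x)))) 0"
      using x_range by (intro isCont_cdf_convolution isCont_cdf_scaled_abs_normal
        real_distribution_scaled_abs_normal) simp
  qed (auto intro: real_distribution_convolution real_distribution_scaled_abs_normal)
  show "eventually (\<lambda>n. cdf (distr env borel (?D n)) (s n)
      = \<P>(\<omega> in env. barrier_difference \<omega> (q n) n \<le> s n * (\<sigma> * sqrt n))) sequentially"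
    using eventually_gt_at_top[of 0]
    by eventually_elim (simp add: env.cdf_distr \<sigma>_pos pos_divide_le_eq)
qed

lemma AE_env_elliptic: "AE \<omega> in env. \<forall>y. 0 < \<omega> y \<and> \<omega> y < 1"
proof -
  have "AE \<omega> in env. 0 < \<omega> y \<and> \<omega> y < 1" for y
    by (rule AE_PiM_component[of UNIV "\<lambda>_. mu" y, OF prob_space_axioms UNIV_I elliptic])
  then show ?thesis unfolding AE_all_countable by blast
qed

lemma annealed_dright_less_le:
  assumes "1 \<le> q" "q \<le> n"
  shows "\<P>(z in env \<Otimes>\<^sub>M noise. dright (fst z) (snd z) n < int q)
    \<le> 1 - \<P>(\<omega> in env. barrier_difference \<omega> q n \<le> - c) + (real n)\<^sup>2 * exp (- c)"
proof -
  have "AE \<omega> in env. \<P>(U in noise. dright \<omega> U n < int q) \<le> (real n)\<^sup>2 * exp (barrier_difference \<omega> q n)"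
    using AE_env_elliptic by eventually_elim (intro quenched_dright_less assms, simp)
  then have "\<P>(z in env \<Otimes>\<^sub>M noise. dright (fst z) (snd z) n < int q)
      \<le> \<P>(\<omega> in env. - c < barrier_difference \<omega> q n) + (real n)\<^sup>2 * exp (- c)"
    by (intro annealed_prob_le_quenched) measurable
  then show ?thesis
    using env.prob_neg[of "\<lambda>\<omega>. barrier_difference \<omega> q n \<le> - c"] by (simp add: not_le)
qed

lemma annealed_dright_less_ge:
  assumes "1 \<le> q" "q \<le> n"
  shows "1 - \<P>(\<omega> in env. barrier_difference \<omega> q n \<le> c) - (real n)\<^sup>2 * exp (- c)
    \<le> \<P>(z in env \<Otimes>\<^sub>M noise. dright (fst z) (snd z) n < int q)"
proof -
  have "AE \<omega> in env. \<P>(U in noise. \<not> dright \<omega> U n < int q) \<le> (real n)\<^sup>2 * exp (- barrier_difference \<omega> q n)"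
    using AE_env_elliptic by eventually_elim (intro quenched_dright_ge assms, simp)
  then have "\<P>(z in env \<Otimes>\<^sub>M noise. \<not> dright (fst z) (snd z) n < int q)
      \<le> \<P>(\<omega> in env. - c < - barrier_difference \<omega> q n) + (real n)\<^sup>2 * exp (- c)"
    by (intro annealed_prob_le_quenched) measurable
  also have "\<P>(\<omega> in env. - c < - barrier_difference \<omega> q n) \<le> \<P>(\<omega> in env. barrier_difference \<omega> q n \<le> c)"
    by (intro env.finite_measure_mono) auto
  finally show ?thesis
    using annealed.prob_neg[of "\<lambda>z. dright (fst z) (snd z) n < int q"] by simp
qed

lemma annealed_dright_less_limit:
  fixes q :: "nat \<Rightarrow> nat"
  assumes x_range: "0 < x" "x < 1" and q_ratio: "(\<lambda>n. real (q n) / real n) \<longlonglongrightarrow> x"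
  shows "(\<lambda>n. \<P>(z in env \<Otimes>\<^sub>M noise. dright (fst z) (snd z) n < int (q n))) \<longlonglongrightarrow> cdf arcsine_distribution x"
proof (rule tendsto_sandwich)
  define s where "s n = real n powr (-1/4)" for n
  define c where "c n = s n * (\<sigma> * sqrt n)" for n
    \<comment> \<open>any threshold of order between \<open>log n\<close> and \<open>\<surd>n\<close>, both excluded, would do\<close>
  define \<delta> where "\<delta> n = (real n)\<^sup>2 * exp (- c n)" for n
  define B where "B n t = \<P>(\<omega> in env. barrier_difference \<omega> (q n) n \<le> t)" for n t
  let ?P = "\<lambda>n. \<P>(z in env \<Otimes>\<^sub>M noise. dright (fst z) (snd z) n < int (q n))"
  have "s \<longlonglongrightarrow> 0" unfolding s_def by real_asymp
  have "\<delta> \<longlonglongrightarrow> 0" unfolding \<delta>_def c_def s_def using \<sigma>_pos by real_asymp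
  have B_lim: "(\<lambda>n. B n (c n)) \<longlonglongrightarrow> 1 - cdf arcsine_distribution x"
    "(\<lambda>n. B n (- c n)) \<longlonglongrightarrow> 1 - cdf arcsine_distribution x"
    using barrier_difference_limit[OF x_range q_ratio \<open>s \<longlonglongrightarrow> 0\<close>]
      barrier_difference_limit[OF x_range q_ratio, of "\<lambda>n. - s n"] tendsto_minus[OF \<open>s \<longlonglongrightarrow> 0\<close>]
    by (simp_all add: B_def c_def)
  note range = eventually_index_in_range[OF x_range q_ratio]
  show "eventually (\<lambda>n. 1 - B n (c n) - \<delta> n \<le> ?P n) sequentially"
    using range by eventually_elim (simp only: B_def \<delta>_def annealed_dright_less_ge)
  show "eventually (\<lambda>n. ?P n \<le> 1 - B n (- c n) + \<delta> n) sequentially"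
    using range by eventually_elim (simp only: B_def \<delta>_def annealed_dright_less_le)
  show "(\<lambda>n. 1 - B n (c n) - \<delta> n) \<longlonglongrightarrow> cdf arcsine_distribution x"
    using tendsto_diff[OF tendsto_diff[OF tendsto_const[of 1] B_lim(1)] \<open>\<delta> \<longlonglongrightarrow> 0\<close>] by simp
  show "(\<lambda>n. 1 - B n (- c n) + \<delta> n) \<longlonglongrightarrow> cdf arcsine_distribution x"
    using tendsto_add[OF tendsto_diff[OF tendsto_const[of 1] B_lim(2)] \<open>\<delta> \<longlonglongrightarrow> 0\<close>] by simp
qed

definition right_end_law :: "nat \<Rightarrow> real measure" where
  "right_end_law n = distr (env \<Otimes>\<^sub>M noise) borel (\<lambda>z. real_of_int (dright (fst z) (snd z) n) / real n)"

lemma scaled_dright_measurable [measurable]: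
  "(\<lambda>z. real_of_int (dright (fst z) (snd z) n) / real n) \<in> borel_measurable (env \<Otimes>\<^sub>M noise)"
  by (rule measurable_compose[OF dright_measurable]) simp

lemma real_distribution_right_end_law: "real_distribution (right_end_law n)"
  unfolding right_end_law_def by (intro annealed.real_distribution_distr) simp

theorem right_end_law_weak_conv: "weak_conv_m right_end_law arcsine_distribution"
proof (rule weak_conv_m_Ioo_support[OF real_distribution_right_end_law real_distribution_arcsine])
  show "measure arcsine_distribution {0<..<1} = 1"
    using interval_integral_arcsine_density[of 0 1]
    by (simp add: measure_arcsine_distribution_Ioo zero_ereal_def one_ereal_def)
  fix x :: real assume x_range: "0 < x" "x < 1"
  define q where "q n = nat (\<lfloor>x * real n\<rfloor> + 1)" for n
  have "\<lfloor>x * real n\<rfloor> + 1 \<ge> 0" for n using x_range by (simp add: add_nonneg_nonneg)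
  then have q_eq: "real (q n) = real_of_int \<lfloor>x * real n\<rfloor> + 1" "int (q n) = \<lfloor>x * real n\<rfloor> + 1" for n
    by (auto simp: q_def)
  have "(\<lambda>n. real (q n) / real n) \<longlonglongrightarrow> x" unfolding q_eq by real_asymp
  from annealed_dright_less_limit[OF x_range this]
  show "(\<lambda>n. cdf (right_end_law n) x) \<longlonglongrightarrow> cdf arcsine_distribution x"
  proof (rule Lim_transform_eventually)
    show "eventually (\<lambda>n. \<P>(z in env \<Otimes>\<^sub>M noise. dright (fst z) (snd z) n < int (q n))
        = cdf (right_end_law n) x) sequentially"
      using eventually_gt_at_top[of 0]
      by eventually_elim (simp add: right_end_law_def annealed.cdf_distr q_eq le_floor_iff divide_le_eq)
  qed
qed

lemma right_end_law_Ioo_tendsto: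
  "(\<lambda>n. measure (right_end_law n) {a<..<b}) \<longlonglongrightarrow> measure arcsine_distribution {a<..<b}"
proof (rule weak_conv_imp_continuity_set_conv[OF real_distribution_right_end_law
      real_distribution_arcsine right_end_law_weak_conv])
  have "closure {a<..<b} \<subseteq> {a..b}" by (rule closure_minimal) auto
  then have "frontier {a<..<b} \<subseteq> {a, b}" by (auto simp: frontier_def interior_open)
  moreover have "measure arcsine_distribution {a, b} = 0"
    using isCont_cdf_arcsine
    by (subst arcsine.finite_measure_eq_sum_singleton) (auto simp: arcsine.isCont_cdf sum_nonneg)
  ultimately show "emeasure arcsine_distribution (frontier {a<..<b}) = 0"
    using emeasure_mono[of "frontier {a<..<b}" "{a, b}" arcsine_distribution]
    by (simp add: arcsine.emeasure_eq_measure)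
qed simp

end

lemma (in environment) sinai_environmentI:
  assumes "prob {0..1} = 1" "prob {0} = 0" "prob {1} = 0" and not_half: "\<not> (AE x in mu. x = 1 / 2)"
    and mean: "expectation log_ratio = 0" and square: "integrable mu (\<lambda>x. (log_ratio x)\<^sup>2)"
  shows "sinai_environment mu"
proof unfold_locales
  have "AE x in mu. x \<in> {0..1}" using assms(1) by (intro AE_prob_1) simp
  moreover have "AE x in mu. x \<notin> {0}" "AE x in mu. x \<notin> {1}"
    using assms(2,3) prob_eq_0[of "{0}"] prob_eq_0[of "{1}"] by auto
  ultimately show elliptic: "AE x in mu. 0 < x \<and> x < 1" by eventually_elim auto
  have "expectation (\<lambda>x. (log_ratio x)\<^sup>2) \<noteq> 0"
  proof
    assume "expectation (\<lambda>x. (log_ratio x)\<^sup>2) = 0"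
    then have "AE x in mu. (log_ratio x)\<^sup>2 = 0"
      using square by (subst (asm) integral_nonneg_eq_0_iff_AE) auto
    with elliptic have "AE x in mu. x = 1 / 2"
    proof eventually_elim
      case (elim x)
      then have "(1 - x) / x = 1" by (simp add: log_ratio_def)
      then show ?case using elim by (simp add: field_simps)
    qed
    with not_half show False by contradiction
  qed
  moreover have "0 \<le> expectation (\<lambda>x. (log_ratio x)\<^sup>2)" by simp
  ultimately show "0 < expectation (\<lambda>x. (log_ratio x)\<^sup>2)" by linarith
qed (fact mean square)+

theorem theorem1:
  fixes mu :: "real measure" and a b :: real
  assumes "prob_space mu"
    and "sets mu = sets borel"
    and "measure mu {0..1} = 1"
    and "measure mu {0} = 0" and "measure mu {1} = 0"
    and "\<not> (AE x in mu. x = 1/2)"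
    and "integrable mu (\<lambda>x. ln ((1 - x) / x))"
    and "(\<integral>x. ln ((1 - x) / x) \<partial>mu) = 0"
    and "integrable mu (\<lambda>x. (ln ((1 - x) / x))\<^sup>2)"
    and "0 \<le> a" and "a \<le> b" and "b \<le> 1"
  shows "(\<lambda>n. measure (annealed_space mu)
            {z \<in> space (annealed_space mu).
               real_of_int (dright (fst z) (snd z) n) / real n \<in> {a<..<b}})
         \<longlonglongrightarrow> (LBINT x=a..b. 1 / (pi * sqrt (x * (1 - x))))"
proof -
  interpret environment mu
    using assms(1,2) by (simp add: environment_def real_distribution_def real_distribution_axioms_def)
  interpret sinai_environment mu
    using assms(3-9) by (intro sinai_environmentI) (simp_all add: log_ratio_def[abs_def])
  have "measure (annealed_space mu) {z \<in> space (annealed_space mu).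
      real_of_int (dright (fst z) (snd z) n) / real n \<in> {a<..<b}}
      = measure (right_end_law n) {a<..<b}" for n
    unfolding right_end_law_def annealed_space_eq
    by (subst measure_distr) (auto intro: arg_cong[where f = annealed.prob])
  then show ?thesis
    using right_end_law_Ioo_tendsto[of a b] assms(10-12) by (simp add: measure_arcsine_distribution_Ioo)
qed

end
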